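(* Let $q\ge 6$ be a prime power and let $\bar{\mathcal C}$ be an $\mathbb F_q$-conic in an $\mathbb F_q$-subplane $\bar\pi$ of $\mathrm{PG}(2,q^3)$ that is exterior to $\ell_\infty$. In the exact-at-infinity Bruck-Bose representation in $\mathrm{PG}(6,q)$, either $\mathcal V([\mathcal C])$ is a 6-dimensional normal rational curve; or $\mathcal V([\mathcal C])$ is a 3-dimensional normal rational curve of $\mathrm{PG}(6,q)$ and $\mathcal V([\mathcal C])^\star$ consists of a 3-dimensional normal rational curve and three T-lines of $\Sigma_\infty^\star$.
   Context: **$\mathbb F_q$-conics.** An $\mathbb F_q$-subplane of $\mathrm{PG}(2,q^3)$ is a subplane of order $q$; it is secant, tangent or exterior to a line if it meets it in $q+1$, $1$ or $0$ points. An $\mathbb F_q$-conic is a non-degenerate conic of an $\mathbb F_q$-subplane. For an $\mathbb F_q$-conic $\bar{\mathcal C}$, $\bar{\mathcal C}^{+}$ is the unique non-degenerate conic of $\mathrm{PG}(2,q^3)$ containing it, and $\bar{\mathcal C}^{++}$ the unique non-degenerate conic of $\mathrm{PG}(2,q^6)$ containing $\bar{\mathcal C}^+$. A line $\ell_\infty$ of $\mathrm{PG}(2,q^3)$ is fixed as line at infinity. **Normal rational curves.** An $r$-dimensional normal rational curve in $\mathrm{PG}(n,q)$ is a set of points lying in an $r$-space and projectively equivalent to $\{(1,\theta,\dots,\theta^r):\theta\in\mathbb F_q\}\cup\{(0,\dots,0,1)\}$; it extends naturally to a normal rational curve over extension fields. **Conjugacy.** For an $\mathbb F_q$-subplane $\bar\pi$,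 $\bar{\mathsf c}_\pi$ is the collineation $\bar X\mapsto B\bar X^q$ ($B\in\mathrm{GL}(3,q^3)$) of $\mathrm{PG}(2,q^3)$ that has order 3 and fixes $\bar\pi$ pointwise; the same formula defines it on $\mathrm{PG}(2,q^6)$, where it has order 6. **Bose representation.** Embed $\mathrm{PG}(8,q)\subset\mathrm{PG}(8,q^3)\subset\mathrm{PG}(8,q^6)$; $X^q$ is obtained by raising coordinates to the $q$-th power. For a subspace or variety $\mathcal K$ given over $\mathbb F_q$, $\mathcal K^\star$ and $\mathcal K^{\star\star}$ denote its extensions to $\mathbb F_{q^3}$ and $\mathbb F_{q^6}$; for a subspace $\Sigma$ of $\mathrm{PG}(8,q^3)$, $\Sigma^{\star\star}$ is its extension to $\mathrm{PG}(8,q^6)$. Let $\Gamma$ be a plane of $\mathrm{PG}(8,q^3)$ disjoint from $\mathrm{PG}(8,q)$ such that $\Gamma,\Gamma^q,\Gamma^{q^2}$ span $\mathrm{PG}(8,q^3)$. The planes $[\![X]\!]=\langle X,X^q,X^{q^2}\rangle\cap\mathrm{PG}(8,q)$, $X\in\Gamma$, form a regular 2-spread of $\mathrm{PG}(8,q)$. Identify $\mathrm{PG}(2,q^3)$ with $\Gamma$ (and $\mathrm{PG}(2,q^6)$ with $\Gamma^{\star\star}$) by a linear isomorphism, $\bar X\leftrightarrow X$; dropping the bar denotes the corresponding object in $\Gamma$ or $\Gamma^{\star\star}$. **Scroll-planes.** For $X\in\Gamma^{\star\star}$, the $\pi$-scroll-plane is $(\!(X)\!)_\pi=\langle X,(X^{\mathsf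 c_\pi^5})^q,(X^{\mathsf c_\pi^4})^{q^2}\rangle$; for $X\in\Gamma$ this is $\langle X,(X^{\mathsf c_\pi^2})^q,(X^{\mathsf c_\pi})^{q^2}\rangle$. **Exact-at-infinity Bruck-Bose representation.** Let $g\subset\Gamma$ be the line corresponding to $\ell_\infty$, $\Sigma_\infty=\langle g,g^q,g^{q^2}\rangle\cap\mathrm{PG}(8,q)$ (a 5-space), and $\Sigma_{6,q}\cong\mathrm{PG}(6,q)$ a 6-space of $\mathrm{PG}(8,q)$ containing $\Sigma_\infty$ as its hyperplane at infinity. The planes $[\![X]\!]$, $X\in g$, form a regular 2-spread $\mathcal S$ of $\Sigma_\infty$, with transversal lines $g,g^q,g^{q^2}$. A T-line of $\Sigma_\infty^\star$ is a line meeting two of $g,g^q,g^{q^2}$. For a point $\bar X$ let $[X]=[\![X]\!]\cap\Sigma_{6,q}$: a point of $\Sigma_{6,q}\setminus\Sigma_\infty$ if $\bar X\notin\ell_\infty$, the spread plane $[\![X]\!]$ if $\bar X\in\ell_\infty$. $[\mathcal C]$ is the set of points lying in the $[X]$, $\bar X\in\bar{\mathcal C}$. **Varieties.** It is known that the pointset of $\{[\![X]\!]:X\in\mathcal C\}$ is an intersection $\mathcal V([\![\mathcal C]\!])$ of nine quadrics of $\mathrm{PG}(8,q)$, that $\mathcal V([\![\mathcal C]\!])^\star$ is the set of points on the planes $(\!(X)\!)_\pi$, $X\in\mathcal C^+$, and $\mathcal V([\![\mathcal C]\!])^{\star\star}$ is the set of points on the planes $(\!(X)\!)_\pi$, $X\in\mathcal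 C^{++}$. Put $\mathcal V([\mathcal C])=\mathcal V([\![\mathcal C]\!])\cap\Sigma_{6,q}$ (its pointset is $[\mathcal C]$), with extension $\mathcal V([\mathcal C])^\star=\mathcal V([\![\mathcal C]\!])^\star\cap\Sigma_{6,q}^\star$. *)

theory Defs
  imports "HOL-Analysis.Analysis" "HOL-Number_Theory.Prime_Powers"
begin

text \<open>
  Throughout, the finite field type \<open>'k\<close> plays the role of the field with $q^3$ elements, and a
  projective space of dimension $n$ over it consists of the one-dimensional subspaces of the
  $(n+1)$-dimensional coordinate space. Points and subspaces are identified with the set of all
  their vectors. Spaces over the subfield with $q$ elements are not separate types: a point of
  $PG(n,q)$ is a point of $PG(n,q^3)$ that has a nonzero coordinate vector over the subfield.
\<close>

definition Fq :: "nat \<Rightarrow> 'k::{field,finite} set" where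
  "Fq q = {x. x ^ q = x}"

definition vecs_over :: "'k::{field,finite} set \<Rightarrow> ('k ^ 'n) set" where
  "vecs_over F = {v. \<forall>i. v $ i \<in> F}"

definition PG :: "'k::{field,finite} set \<Rightarrow> ('k ^ 'n) set set" where
  "PG F = {vec.span {v} | v. v \<in> vecs_over F \<and> v \<noteq> 0}"

definition pts :: "('k::{field,finite} ^ 'n) set \<Rightarrow> ('k ^ 'n) set set" where
  "pts W = {P \<in> PG UNIV. P \<subseteq> W}"

definition pg_subspace :: "nat \<Rightarrow> ('k::{field,finite} ^ 'n) set \<Rightarrow> bool" where
  "pg_subspace r W \<longleftrightarrow> vec.subspace W \<and> vec.dim W = r + 1"

text \<open>
  The \<open>r\<close>-spaces of the geometry over the subfield \<open>F\<close>, as sets of points. A point of \<open>PG F\<close> lies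
  in the span of \<open>D\<close> over the big field iff it lies in the span of \<open>D\<close> over \<open>F\<close>, because the
  vectors in \<open>D\<close> have coordinates in \<open>F\<close>.
\<close>

definition subgeom_space ::
    "'k::{field,finite} set \<Rightarrow> nat \<Rightarrow> ('k ^ 'n) set set \<Rightarrow> bool" where
  "subgeom_space F r S \<longleftrightarrow>
     (\<exists>D. D \<subseteq> vecs_over F \<and> vec.independent D \<and> card D = r + 1 \<and>
          S = PG F \<inter> pts (vec.span D))"

text \<open>The extension to $PG(n,q^3)$ of a subspace of $PG(n,q)$.\<close>

definition space_star :: "('k::{field,finite} ^ 'n) set set \<Rightarrow> ('k ^ 'n) set set" where
  "space_star S = pts (vec.span (\<Union>S))"

text \<open>
  Frobenius conjugation. For a point or subspace \<open>S\<close>, the image \<open>frob q ` S\<close> is $S^q$ and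
  \<open>frob (q^2) ` S\<close> is $S^{q^2}$.
\<close>

definition frob :: "nat \<Rightarrow> 'k::{field,finite} ^ 'n \<Rightarrow> 'k ^ 'n" where
  "frob m v = (\<chi> i. (v $ i) ^ m)"

definition conj_span :: "nat \<Rightarrow> ('k::{field,finite} ^ 'n) set \<Rightarrow> ('k ^ 'n) set" where
  "conj_span q S = vec.span (S \<union> frob q ` S \<union> frob (q^2) ` S)"


section \<open>Subplanes and conics\<close>

definition homography :: "'k::{field,finite} ^ 'n ^ 'n \<Rightarrow> ('k ^ 'n) set \<Rightarrow> ('k ^ 'n) set" where
  "homography A P = (\<lambda>v. A *v v) ` P"

text \<open>
  A subplane of order \<open>q\<close>: the points of \<open>S\<close>, together with the lines that join two of them, form
  a projective plane of order \<open>q\<close>. That two points lie on a unique line is inherited from the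
  ambient plane.
\<close>

definition subplane_line ::
    "('k::{field,finite} ^ 3) set set \<Rightarrow> ('k ^ 3) set \<Rightarrow> bool" where
  "subplane_line S l \<longleftrightarrow>
     pg_subspace 1 l \<and> (\<exists>P\<in>S. \<exists>Q\<in>S. P \<noteq> Q \<and> P \<subseteq> l \<and> Q \<subseteq> l)"

definition subplane_of_order :: "nat \<Rightarrow> ('k::{field,finite} ^ 3) set set \<Rightarrow> bool" where
  "subplane_of_order q S \<longleftrightarrow>
     S \<subseteq> PG UNIV \<and>
     (\<forall>l m. subplane_line S l \<and> subplane_line S m \<longrightarrow> (\<exists>P\<in>S. P \<subseteq> l \<and> P \<subseteq> m)) \<and>
     (\<exists>Q. Q \<subseteq> S \<and> card Q = 4 \<and> (\<forall>l. pg_subspace 1 l \<longrightarrow> card {P \<in> Q. P \<subseteq> l} \<le> 2)) \<and>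
     (\<forall>l. subplane_line S l \<longrightarrow> card {P \<in> S. P \<subseteq> l} = q + 1)"

definition qform :: "'k::{field,finite} ^ 'n ^ 'n \<Rightarrow> 'k ^ 'n \<Rightarrow> 'k" where
  "qform M v = (\<Sum>i\<in>UNIV. \<Sum>j\<in>UNIV. M $ i $ j * v $ i * v $ j)"

definition polar :: "'k::{field,finite} ^ 'n ^ 'n \<Rightarrow> 'k ^ 'n \<Rightarrow> 'k ^ 'n \<Rightarrow> 'k" where
  "polar M v w = qform M (v + w) - qform M v - qform M w"

text \<open>
  Non-degenerate conics of \<open>PG F\<close>. The matrix \<open>M\<close> need not be symmetric, so that all quadratic
  forms occur in characteristic 2 as well. Non-degeneracy means that there is no singular point,
  the values \<open>polar M v (axis i 1)\<close> being the partial derivatives of the form at \<open>v\<close>. As finite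
  fields are perfect, it is enough to consider points over the field of definition.
\<close>

definition nondegenerate_conic ::
    "'k::{field,finite} set \<Rightarrow> ('k ^ 3) set set \<Rightarrow> bool" where
  "nondegenerate_conic F C \<longleftrightarrow>
     (\<exists>M. (\<forall>i j. M $ i $ j \<in> F) \<and>
          \<not> (\<exists>v \<in> vecs_over F. v \<noteq> 0 \<and> qform M v = 0 \<and> (\<forall>w \<in> vecs_over F. polar M v w = 0)) \<and>
          C = {vec.span {v} | v. v \<in> vecs_over F \<and> v \<noteq> 0 \<and> qform M v = 0})"

text \<open>
  A non-degenerate conic of the subplane \<open>S\<close>; \<open>S\<close> is coordinatised by a homography that maps
  $PG(2,q)$ onto it.
\<close>

definition Fq_conic_in ::
    "nat \<Rightarrow> ('k::{field,finite} ^ 3) set set \<Rightarrow> ('k ^ 3) set set \<Rightarrow> bool" where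
  "Fq_conic_in q S C \<longleftrightarrow>
     (\<exists>A D. invertible A \<and> homography A ` PG (Fq q) = S \<and>
            nondegenerate_conic (Fq q) D \<and> C = homography A ` D)"

definition semilinear_coll ::
    "nat \<Rightarrow> 'k::{field,finite} ^ 'n ^ 'n \<Rightarrow> ('k ^ 'n) set \<Rightarrow> ('k ^ 'n) set" where
  "semilinear_coll q B P = (\<lambda>v. B *v frob q v) ` P"

text \<open>The map induced by \<open>B\<close> on the points of $PG(2,q^3)$ is determined by this condition.\<close>

definition conjugacy_matrix ::
    "nat \<Rightarrow> ('k::{field,finite} ^ 3) set set \<Rightarrow> 'k ^ 3 ^ 3 \<Rightarrow> bool" where
  "conjugacy_matrix q S B \<longleftrightarrow>
     invertible B \<and>
     (\<forall>P\<in>PG UNIV. (semilinear_coll q B ^^ 3) P = P) \<and>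
     (\<forall>k\<in>{1,2}. \<exists>P\<in>PG UNIV. (semilinear_coll q B ^^ k) P \<noteq> P) \<and>
     (\<forall>P\<in>S. semilinear_coll q B P = P)"


section \<open>Normal rational curves\<close>

text \<open>
  An \<open>r\<close>-dimensional normal rational curve over \<open>F\<close>: the vectors \<open>b 0, \<dots>, b r\<close> form a basis of the
  \<open>r\<close>-space, and the standard curve is transported by the homography that maps the standard basis
  to them.
\<close>

definition normal_rational_curve ::
    "'k::{field,finite} set \<Rightarrow> nat \<Rightarrow> ('k ^ 'n) set set \<Rightarrow> bool" where
  "normal_rational_curve F r N \<longleftrightarrow>
     (\<exists>b :: nat \<Rightarrow> 'k ^ 'n.
        (\<forall>i\<le>r. b i \<in> vecs_over F) \<and> inj_on b {..r} \<and> vec.independent (b ` {..r}) \<and>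
        N = {vec.span {\<Sum>i\<le>r. \<theta> ^ i *s b i} | \<theta>. \<theta> \<in> F} \<union> {vec.span {b r}})"


section \<open>The Bose and Bruck--Bose representations\<close>

text \<open>
  \<open>\<phi>\<close> is the linear identification of $PG(2,q^3)$ with the plane \<open>\<Gamma>\<close> of $PG(8,q^3)$.
\<close>

definition bose_embedding ::
    "nat \<Rightarrow> ('k::{field,finite} ^ 9) set \<Rightarrow> ('k ^ 3 \<Rightarrow> 'k ^ 9) \<Rightarrow> bool" where
  "bose_embedding q \<Gamma> \<phi> \<longleftrightarrow>
     pg_subspace 2 \<Gamma> \<and> pts \<Gamma> \<inter> PG (Fq q) = {} \<and> conj_span q \<Gamma> = UNIV \<and>
     Vector_Spaces.linear (*s) (*s) \<phi> \<and> inj \<phi> \<and> range \<phi> = \<Gamma>"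

text \<open>
  For a point \<open>X\<close> of \<open>\<Gamma>\<close> this is the spread plane of \<open>X\<close>; for the line \<open>g\<close> at infinity it is the
  5-space at infinity.
\<close>

definition bose_space :: "nat \<Rightarrow> ('k::{field,finite} ^ 9) set \<Rightarrow> ('k ^ 9) set set" where
  "bose_space q S = pts (conj_span q S) \<inter> PG (Fq q)"

definition scroll_plane ::
    "nat \<Rightarrow> ('k::{field,finite} ^ 3 \<Rightarrow> 'k ^ 9) \<Rightarrow> 'k ^ 3 ^ 3 \<Rightarrow> ('k ^ 3) set \<Rightarrow> ('k ^ 9) set" where
  "scroll_plane q \<phi> B X =
     vec.span (\<phi> ` X
       \<union> frob q ` \<phi> ` (semilinear_coll q B ^^ 2) X
       \<union> frob (q^2) ` \<phi> ` semilinear_coll q B X)"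

definition V_bose ::
    "nat \<Rightarrow> ('k::{field,finite} ^ 3 \<Rightarrow> 'k ^ 9) \<Rightarrow> ('k ^ 3) set set \<Rightarrow> ('k ^ 9) set set" where
  "V_bose q \<phi> C = (\<Union>X\<in>C. bose_space q (\<phi> ` X))"

text \<open>
  The extension to $PG(8,q^3)$ of the variety (an intersection of nine quadrics over the small
  field) whose points in $PG(8,q)$ are those of \<open>V_bose q \<phi> C\<close>: it consists of the points on the
  scroll-planes of the points of \<open>Cp\<close>, the non-degenerate conic of $PG(2,q^3)$ containing the given
  conic \<open>C\<close>.
\<close>

definition V_bose_star ::
    "nat \<Rightarrow> ('k::{field,finite} ^ 3 \<Rightarrow> 'k ^ 9) \<Rightarrow> 'k ^ 3 ^ 3 \<Rightarrow> ('k ^ 3) set set \<Rightarrow> ('k ^ 9) set set" where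
  "V_bose_star q \<phi> B Cp = (\<Union>X\<in>Cp. pts (scroll_plane q \<phi> B X))"

definition T_line :: "nat \<Rightarrow> ('k::{field,finite} ^ 9) set \<Rightarrow> ('k ^ 9) set \<Rightarrow> bool" where
  "T_line q g t \<longleftrightarrow>
     pg_subspace 1 t \<and> t \<subseteq> conj_span q g \<and>
     (\<exists>h k. {h, k} \<subseteq> {g, frob q ` g, frob (q^2) ` g} \<and> h \<noteq> k \<and>
            pts t \<inter> pts h \<noteq> {} \<and> pts t \<inter> pts k \<noteq> {})"

end

theory Submission
  imports Defs
begin

text \<open>
  In coordinates adapted to the subplane the conic consists of the points \<open>w = (1, t, t\<^sup>2)\<close> and
  \<open>(0, 0, 1)\<close>, and the plane of \<open>w\<close> is spanned by \<open>E 0 w\<close>, \<open>E 1 w\<close>, \<open>E 2 w\<close> for three conjugate linear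
  maps whose ranges are complementary. The six-space consists of the sums \<open>E 0 x + E 1 y + E 2 z\<close> on
  which three conjugate linear forms take equal values at \<open>x\<close>, \<open>y\<close>, \<open>z\<close>. Evaluated on the conic these
  forms are quadratic polynomials \<open>f 0\<close>, \<open>f 1\<close>, \<open>f 2\<close> in \<open>t\<close>, without roots over the small field because
  the subplane is exterior. So the plane of \<open>w\<close> meets the six-space in the sums of the vectors
  \<open>c j *s E j w\<close> such that \<open>c j * f j t\<close> does not depend on \<open>j\<close>.

  If \<open>f 0\<close> and \<open>f 1\<close> are coprime, then \<open>c j = f (j + 1) * f (j + 2)\<close> gives a curve of degree 6 whose
  coefficient vectors are independent by partial fractions. Otherwise \<open>f 0\<close> is a multiple of
  \<open>(X - \<rho>) (X - \<rho>\<^sup>q)\<close>; common factors cancel and leave a curve of degree 3, and at each of the three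
  conjugates of \<open>\<rho>\<close> two of the three polynomials vanish, so that the plane contributes a whole line,
  which is a T-line.
\<close>

section \<open>The cubic extension and its subfield\<close>

text \<open>The equation of the six-space comes from a dimension count. Its extension has
  codimension 2, contains the common kernel of the three forms, and has a vector over the small
  field outside that kernel. Such a vector has conjugate components, so after scaling all three
  forms are 1 there; equality of the three values is then the only possible condition. That the
  subplane is exterior means that the coefficients of the form are independent over the small field.
  Besides excluding roots there, this prevents \<open>f 0\<close> and \<open>f 1\<close> from being
  proportional. A proper common factor is therefore linear and its root lies in the field of q^3
  elements, so the dichotomy is decided without entering a larger field. The bound on q serves to
  identify \<open>C_plus\<close>: its equation restricts to a quartic in the parameter, which
  vanishes once it has more than 4 roots.\<close>

lemma card_CHAR_power:
  assumes "primepow q" "CARD('k::{field,finite}) = q ^ 3"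
  obtains n where "prime CHAR('k)" "q = CHAR('k) ^ n" "n > 0"
proof -
  have pos: "CHAR('k) > 0" by (rule finite_imp_CHAR_pos) simp
  have pr: "prime CHAR('k)" using pos by (rule prime_CHAR_semidom)
  obtain p n where pn: "prime p" "n > 0" "q = p ^ n"
    using assms(1) by (auto simp: primepow_def)
  \<comment> \<open>Translation by 1 permutes the field; comparing the two sums shows that q^3 times
    1 is 0.\<close>
  have "(\<Sum>x\<in>UNIV. x + 1 :: 'k) = (\<Sum>x\<in>UNIV. x)"
    by (rule sum.reindex_bij_witness[of _ "\<lambda>x. x - 1" "\<lambda>x. x + 1"]) auto
  then have "of_nat (q ^ 3) = (0 :: 'k)" by (simp add: sum.distrib assms(2) del: of_nat_power)
  then have "CHAR('k) dvd q ^ 3" by (simp only: of_nat_eq_0_iff_char_dvd)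
  then have "CHAR('k) dvd p" using pr pn by (metis prime_dvd_power)
  then have "CHAR('k) = p" using pr pn by (simp add: primes_dvd_imp_eq)
  then show ?thesis using that pn pr by blast
qed

locale cubic_extension =
  fixes q :: nat and K :: "'k::{field,finite} itself"
  assumes primepow: "primepow q" and card_K: "CARD('k) = q ^ 3"
begin

abbreviation F :: "'k set" where "F \<equiv> Fq q"

lemma q_gt_1: "q > 1"
  using primepow_gt_Suc_0[OF primepow] by simp

lemma q_pos: "q > 0"
  using q_gt_1 by simp

lemma power_q_add: "(x + y :: 'k) ^ q = x ^ q + y ^ q"
proof -
  obtain n where "prime CHAR('k)" "q = CHAR('k) ^ n"
    using card_CHAR_power[OF primepow card_K] by blast
  then show ?thesis by (rule freshmans_dream')
qed

lemma of_nat_q: "of_nat q = (0 :: 'k)"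
proof -
  obtain n where "prime CHAR('k)" "q = CHAR('k) ^ n" "n > 0"
    using card_CHAR_power[OF primepow card_K] by blast
  then show ?thesis by (simp add: of_nat_power power_0_left)
qed

lemma power_q_sum: "(\<Sum>i\<in>A. f i :: 'k) ^ q = (\<Sum>i\<in>A. f i ^ q)"
  by (induction A rule: infinite_finite_induct) (use q_pos in \<open>auto simp: power_q_add power_0_left\<close>)

lemma power_q_diff: "(x - y :: 'k) ^ q = x ^ q - y ^ q"
  using power_q_add[of "x - y" y] by (simp add: algebra_simps)

lemma power_qj_add: "(x + y :: 'k) ^ (q ^ j) = x ^ (q ^ j) + y ^ (q ^ j)"
  by (induction j) (simp_all add: power_mult power_q_add mult.commute[of q])

lemma power_qj_sum: "(\<Sum>i\<in>A. f i :: 'k) ^ (q ^ j) = (\<Sum>i\<in>A. f i ^ (q ^ j))"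
  by (induction A rule: infinite_finite_induct) (use q_pos in \<open>auto simp: power_qj_add power_0_left\<close>)

lemma power_q3: "(x :: 'k) ^ (q ^ 3) = x"
proof (cases "x = 0")
  case False
  \<comment> \<open>Multiplication by \<open>x\<close> permutes the nonzero elements, so their
    product absorbs a factor \<open>x\<close> for each of them.\<close>
  have "bij_betw ((*) x) (- {0}) (- {0})"
    by (rule bij_betwI[of _ _ _ "\<lambda>y. y / x"]) (use False in auto)
  then have "\<Prod>(- {0}) = (\<Prod>y\<in>- {0}. x * y)"
    by (rule prod.reindex_bij_betw [symmetric])
  also have "\<dots> = x ^ card (- {0 :: 'k}) * \<Prod>(- {0})" by (simp add: prod.distrib)
  finally have "x ^ card (- {0 :: 'k}) = 1" by simp
  moreover have "Suc (card (- {0 :: 'k})) = q ^ 3"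
    using q_pos by (simp add: card_Diff_singleton card_K Compl_eq_Diff_UNIV)
  ultimately show ?thesis by (metis mult.right_neutral power_Suc)
qed (use q_pos in \<open>simp add: power_0_left\<close>)

lemma power_q2_q: "((x :: 'k) ^ q\<^sup>2) ^ q = x" "((x :: 'k) ^ q) ^ q\<^sup>2 = x"
    "((x ^ q) ^ q) ^ q = x" "(x ^ q) ^ q = x ^ q\<^sup>2"
  using power_q3[of x] by (simp_all flip: power_mult add: power2_eq_square power3_eq_cube mult_ac)

lemma power_q_inj: "(x :: 'k) ^ q = y ^ q \<longleftrightarrow> x = y"
  by (metis power_q2_q(2))

lemma F_iff: "x \<in> F \<longleftrightarrow> x ^ q = x"
  by (simp add: Fq_def)

lemma F_closed [simp, intro]:
  "0 \<in> F" "1 \<in> F" "x \<in> F \<Longrightarrow> y \<in> F \<Longrightarrow> x + y \<in> F" "x \<in> F \<Longrightarrow> y \<in> F \<Longrightarrow> x - y \<in> F"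
  "x \<in> F \<Longrightarrow> y \<in> F \<Longrightarrow> x * y \<in> F" "x \<in> F \<Longrightarrow> - x \<in> F" "x \<in> F \<Longrightarrow> inverse x \<in> F"
  "x \<in> F \<Longrightarrow> y \<in> F \<Longrightarrow> x / y \<in> F" "x \<in> F \<Longrightarrow> x ^ n \<in> F"
proof -
  show neg: "- x \<in> F" if "x \<in> F" for x
    using that power_q_diff[of 0 x] q_pos by (simp add: F_iff power_0_left)
  show "x ^ n \<in> F" if "x \<in> F" for x
    using that by (simp add: F_iff) (metis power_mult mult.commute)
qed (use q_pos in \<open>auto simp: F_iff power_q_add power_q_diff power_mult_distrib power_inverse power_divide power_0_left\<close>)

lemma F_sum [intro]: "(\<And>i. i \<in> A \<Longrightarrow> f i \<in> F) \<Longrightarrow> (\<Sum>i\<in>A. f i) \<in> F"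
  by (induction A rule: infinite_finite_induct) auto

lemma F_power_qj: "x \<in> F \<Longrightarrow> x ^ (q ^ j) = x"
  by (induction j) (simp_all add: power_mult F_iff)

text \<open>At most q elements, as roots of X^q - X. At least q, because every element outside
  \<open>F\<close> is a root of the cofactor of X^q - X in X^(q^3) - X, whose degree is q^3 -
  q.\<close>

lemma card_F: "card F = q"
proof (rule antisym)
  let ?p = "monom 1 q - [:0, 1:] :: 'k poly"
  have deg: "degree ?p = q"
    using q_gt_1 degree_add_eq_left[of "- [:0, 1:]" "monom 1 q :: 'k poly"]
    by (simp add: degree_monom_eq del: minus_pCons)
  then have "?p \<noteq> 0" using q_pos by auto
  then have "card {x. poly ?p x = 0} \<le> degree ?p" by (rule card_poly_roots_bound)
  moreover have "{x. poly ?p x = 0} = F" by (auto simp: Fq_def poly_monom)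
  ultimately show "card F \<le> q" using deg by simp
next
  \<comment> \<open>The cofactor as a geometric sum in X^(q - 1); it has q^2 + q + 1 terms.\<close>
  let ?h = "\<Sum>i\<le>q\<^sup>2 + q. monom 1 ((q - 1) * i) :: 'k poly"
  have root: "poly ?h x = 0" if "x \<notin> F" for x
  proof -
    define y where "y = x ^ (q - 1)"
    have x0: "x \<noteq> 0" using that by auto
    have "x * y = x ^ q" using q_pos by (simp add: y_def power_eq_if)
    then have y1: "y \<noteq> 1" using that x0 by (auto simp: F_iff)
    have e: "Suc ((q - 1) * Suc (q\<^sup>2 + q)) = q ^ 3"
      using q_pos by (cases q) (auto simp: algebra_simps power2_eq_square power3_eq_cube)
    have "x * y ^ Suc (q\<^sup>2 + q) = x ^ Suc ((q - 1) * Suc (q\<^sup>2 + q))"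
      by (simp only: y_def power_mult power_Suc)
    also have "\<dots> = x" by (simp only: e power_q3)
    finally have "y ^ Suc (q\<^sup>2 + q) = 1" using x0 by simp
    then have "(\<Sum>i\<le>q\<^sup>2 + q. y ^ i) = 0"
      using y1 geometric_sum[OF y1, of "Suc (q\<^sup>2 + q)"] by (simp add: lessThan_Suc_atMost del: power_Suc)
    then show ?thesis by (simp add: poly_sum poly_monom y_def power_mult)
  qed
  have dle: "degree ?h \<le> (q - 1) * (q\<^sup>2 + q)"
    by (rule degree_sum_le) (auto intro: order_trans[OF degree_monom_le])
  have "coeff ?h 0 = (\<Sum>i\<le>q\<^sup>2 + q. if i = 0 then 1 else 0)"
    unfolding coeff_sum using q_gt_1 by (intro sum.cong) auto
  then have "coeff ?h 0 = 1" by (simp add: sum.delta)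
  then have h0: "?h \<noteq> 0" by auto
  have "card (- F) \<le> card {x. poly ?h x = 0}" by (rule card_mono) (use root in auto)
  also have "\<dots> \<le> degree ?h" using h0 by (rule card_poly_roots_bound)
  finally have "card (- F) \<le> (q - 1) * (q\<^sup>2 + q)" using dle by simp
  moreover have "card (- F) = q ^ 3 - card F"
    by (simp add: card_Diff_subset card_K Compl_eq_Diff_UNIV)
  moreover have "(q - 1) * (q\<^sup>2 + q) + q = q ^ 3"
    using q_pos by (cases q) (auto simp: algebra_simps power2_eq_square power3_eq_cube)
  ultimately show "q \<le> card F" by linarith
qed

lemma F_power_q_minus_1: "x \<in> F \<Longrightarrow> x \<noteq> 0 \<Longrightarrow> x ^ (q - 1) = 1"
  using q_pos by (metis F_iff mult_cancel_left2 power_eq_if neq0_conv)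

text \<open>For positive \<open>k\<close> some nonzero \<open>a\<close> in \<open>F\<close> has
  \<open>a ^ k\<close> different from 1, and scaling by \<open>a\<close> multiplies the sum by
  \<open>a ^ k\<close>. For \<open>k = 0\<close> every term is 1, including that of 0, and q
  vanishes in the field.\<close>

lemma sum_F_power:
  assumes "k < q - 1"
  shows "(\<Sum>x\<in>F. x ^ k) = 0"
proof (cases "k = 0")
  case True
  then show ?thesis by (simp add: card_F of_nat_q)
next
  case False
  let ?p = "monom 1 k - 1 :: 'k poly"
  have "coeff ?p k = 1" using False by simp
  then have p0: "?p \<noteq> 0" by (metis coeff_0 zero_neq_one)
  have "card {x. poly ?p x = 0} \<le> degree ?p" using p0 by (rule card_poly_roots_bound)
  also have "\<dots> \<le> k" by (rule degree_diff_le) (auto simp: degree_monom_le)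
  finally have "card {x. poly ?p x = 0} < card (F - {0})"
    using assms by (simp add: card_Diff_singleton card_F)
  then have "\<not> F - {0} \<subseteq> {x. poly ?p x = 0}"
    by (meson card_mono finite leD)
  then obtain a where a: "a \<in> F" "a \<noteq> 0" "a ^ k \<noteq> 1" by (auto simp: poly_monom)
  have "(\<Sum>x\<in>F. x ^ k) = (\<Sum>x\<in>F. (a * x) ^ k)"
    by (rule sum.reindex_bij_witness[of _ "\<lambda>x. a * x" "\<lambda>x. x / a"]) (use a in auto)
  also have "\<dots> = a ^ k * (\<Sum>x\<in>F. x ^ k)" by (simp add: power_mult_distrib sum_distrib_left)
  finally show ?thesis using a by simp
qed

end

section \<open>Polynomial functions on coordinate vectors and isotropic ternary forms\<close>

inductive poly_fun :: "nat \<Rightarrow> ('k::field ^ 'n \<Rightarrow> 'k) \<Rightarrow> bool" for d where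
  monomial: "(\<Sum>i\<in>UNIV. e i) \<le> d \<Longrightarrow> poly_fun d (\<lambda>v. c * (\<Prod>i\<in>UNIV. v $ i ^ e i))"
| add: "poly_fun d f \<Longrightarrow> poly_fun d g \<Longrightarrow> poly_fun d (\<lambda>v. f v + g v)"

lemma poly_fun_const: "poly_fun d (\<lambda>v. c)"
  using poly_fun.monomial[of "\<lambda>_. 0" d c] by simp

lemma poly_fun_coord: "poly_fun 1 (\<lambda>v :: 'a::field ^ 'b. v $ i)"
proof -
  have "(\<Prod>l\<in>UNIV. v $ l ^ (if l = i then 1 else 0)) = v $ i" for v :: "'a::field ^ 'b"
    by (subst prod.remove[of UNIV i]) auto
  then show ?thesis
    using poly_fun.monomial[of "\<lambda>l. if l = i then 1 else 0" 1 "1 :: 'a"] by simp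
qed

lemma poly_fun_sum: "(\<And>x. x \<in> A \<Longrightarrow> poly_fun d (f x)) \<Longrightarrow> poly_fun d (\<lambda>v. \<Sum>x\<in>A. f x v)"
  by (induction A rule: infinite_finite_induct) (auto intro: poly_fun_const poly_fun.add)

lemma poly_fun_mult:
  assumes "poly_fun d f" "poly_fun d' g"
  shows "poly_fun (d + d') (\<lambda>v. f v * g v)"
  using assms(1)
proof (induction rule: poly_fun.induct)
  case (monomial e c)
  from assms(2) show ?case
  proof (induction rule: poly_fun.induct)
    case (monomial e' c')
    have "poly_fun (d + d') (\<lambda>v. c * c' * (\<Prod>i\<in>UNIV. v $ i ^ (e i + e' i)))"
      by (rule poly_fun.monomial) (use monomial \<open>sum e UNIV \<le> d\<close> in \<open>simp add: sum.distrib\<close>)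
    then show ?case by (simp add: power_add prod.distrib mult_ac)
  next
    case (add f g)
    then show ?case by (simp add: distrib_left poly_fun.add)
  qed
next
  case (add f g)
  then show ?case by (simp add: distrib_right poly_fun.add)
qed

lemma poly_fun_power: "poly_fun d f \<Longrightarrow> poly_fun (n * d) (\<lambda>v. f v ^ n)"
  by (induction n) (auto intro: poly_fun_const poly_fun_mult)

context cubic_extension
begin

text \<open>On a monomial the sum factorises over the coordinates. The degree bound forces some
  exponent below q - 1, and the factor of that coordinate vanishes by
  \<open>sum_F_power\<close>.\<close>

lemma sum_vecs_over_F_poly_fun:
  fixes f :: "'k ^ 'n \<Rightarrow> 'k"
  assumes "poly_fun d f" "d < CARD('n) * (q - 1)"
  shows "(\<Sum>v\<in>vecs_over F. f v) = 0"
  using assms(1)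
proof (induction rule: poly_fun.induct)
  case (monomial e c)
  have "\<exists>i. e i < q - 1"
  proof (rule ccontr)
    assume "\<not> ?thesis"
    then have "(\<Sum>i\<in>(UNIV :: 'n set). q - 1) \<le> (\<Sum>i\<in>UNIV. e i)" by (intro sum_mono) (simp add: not_less)
    then show False using monomial assms(2) by simp
  qed
  then obtain i where i: "e i < q - 1" ..
  have "(\<Sum>v\<in>vecs_over F. \<Prod>i\<in>UNIV. v $ i ^ e i) = (\<Sum>g\<in>PiE UNIV (\<lambda>_. F). \<Prod>i\<in>UNIV. g i ^ e i)"
    by (rule sum.reindex_bij_witness[of _ vec_lambda vec_nth]) (auto simp: vecs_over_def)
  also have "\<dots> = (\<Prod>i\<in>UNIV. \<Sum>x\<in>F. x ^ e i)" by (rule prod_sum_PiE [symmetric]) auto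
  also have "\<dots> = 0" using sum_F_power[OF i] by (auto simp: prod_zero_iff)
  finally show ?case by (simp flip: sum_distrib_left)
qed (simp add: sum.distrib)

lemma qform_in_F: "\<forall>i j. M $ i $ j \<in> F \<Longrightarrow> v \<in> vecs_over F \<Longrightarrow> qform M v \<in> F"
  unfolding qform_def vecs_over_def by (intro F_sum F_closed) auto

text \<open>
  A case of the Chevalley--Warning theorem: summing \<open>qform M v ^ (q - 1)\<close> over \<open>v\<close>, a polynomial of
  degree \<open>2 (q - 1) < 3 (q - 1)\<close>, gives 0, whereas for an anisotropic form it would give \<open>q^3 - 1\<close>.
\<close>

lemma ternary_form_isotropic:
  fixes M :: "'k ^ 3 ^ 3"
  assumes "\<forall>i j. M $ i $ j \<in> F"
  obtains v where "v \<in> vecs_over F" "v \<noteq> 0" "qform M v = 0"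
proof (rule ccontr)
  assume "\<not> thesis"
  then have aniso: "qform M v \<noteq> 0" if "v \<in> vecs_over F" "v \<noteq> 0" for v
    using that \<open>\<And>v. v \<in> vecs_over F \<Longrightarrow> v \<noteq> 0 \<Longrightarrow> qform M v = 0 \<Longrightarrow> thesis\<close> by blast
  have Q: "poly_fun (1 + 1) (qform M)"
    unfolding qform_def
  proof (intro poly_fun_sum)
    fix i j
    have "poly_fun (0 + (1 + 1)) (\<lambda>v. M $ i $ j * (v $ i * v $ j))"
      by (intro poly_fun_mult poly_fun_const poly_fun_coord)
    then show "poly_fun (1 + 1) (\<lambda>v. M $ i $ j * v $ i * v $ j)" by (simp add: mult.assoc)
  qed
  have "(\<Sum>v\<in>vecs_over F. qform M v ^ (q - 1)) = 0"
    by (rule sum_vecs_over_F_poly_fun[OF poly_fun_power[OF Q]]) (use q_gt_1 in simp)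
  moreover have "(\<Sum>v\<in>(vecs_over F :: ('k ^ 3) set). 1) = (0 :: 'k)"
    by (rule sum_vecs_over_F_poly_fun[OF poly_fun_const[of 0]]) (use q_gt_1 in simp)
  ultimately have "(\<Sum>v\<in>vecs_over F. 1 - qform M v ^ (q - 1)) = 0" by (simp add: sum_subtractf)
  moreover have "(\<Sum>v\<in>vecs_over F. 1 - qform M v ^ (q - 1)) = (\<Sum>v\<in>vecs_over F. if v = (0 :: 'k ^ 3) then 1 else (0 :: 'k))"
  proof (rule sum.cong)
    fix v :: "'k ^ 3" assume "v \<in> vecs_over F"
    then show "1 - qform M v ^ (q - 1) = (if v = 0 then 1 else 0)"
      using aniso[of v] F_power_q_minus_1[OF qform_in_F[OF assms, of v]] q_gt_1
      by (auto simp: qform_def)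
  qed simp
  moreover have "(0 :: 'k ^ 3) \<in> vecs_over F" by (simp add: vecs_over_def)
  ultimately show False by (simp add: sum.delta')
qed

end

section \<open>Conics over the subfield and over the extension\<close>

lemma span_singleton_scale: "c \<noteq> 0 \<Longrightarrow> vec.span {c *s v} = vec.span {v :: 'k::field ^ 'n}"
  using vec.span_image_scale[of "{v}" "\<lambda>_. c"] by simp

lemma homography_span_singleton: "homography A (vec.span {v}) = vec.span {A *v v}"
  by (auto simp: homography_def vec.span_singleton vec.scale image_iff)

lemma invertible_iff_ker: "invertible A \<longleftrightarrow> (\<forall>x. A *v x = 0 \<longrightarrow> x = 0)"
  for A :: "'k::field ^ 'n ^ 'n"
  by (simp add: invertible_left_inverse matrix_left_invertible_ker)

lemma invertible_surjE:
  fixes A :: "'k::field ^ 'n ^ 'n"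
  assumes "invertible A"
  obtains y where "w = A *v y"
proof -
  obtain B where "A ** B = mat 1" using assms by (auto simp: invertible_def)
  then have "w = A *v (B *v w)" by (simp add: matrix_vector_mul_assoc)
  then show ?thesis by (rule that)
qed

lemma qform_scale: "qform M (c *s v) = c\<^sup>2 * qform M v"
  by (simp add: qform_def sum_distrib_left power2_eq_square mult_ac)

lemma polar_eq: "polar M v w = (\<Sum>i\<in>UNIV. \<Sum>j\<in>UNIV. M $ i $ j * (v $ i * w $ j + w $ i * v $ j))"
  by (simp add: polar_def qform_def algebra_simps flip: sum.distrib sum_subtractf)

lemma polar_commute: "polar M v w = polar M w v"
  by (simp add: polar_eq add.commute)

lemma polar_add_right: "polar M v (w + u) = polar M v w + polar M v u"
  by (simp add: polar_eq algebra_simps flip: sum.distrib)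

lemma polar_scale_right: "polar M v (c *s w) = c * polar M v w"
  by (simp add: polar_eq sum_distrib_left algebra_simps)

lemma polar_add_left: "polar M (w + u) v = polar M w v + polar M u v"
  by (simp add: polar_add_right polar_commute[of M _ v])

lemma polar_scale_left: "polar M (c *s w) v = c * polar M w v"
  by (simp add: polar_scale_right polar_commute[of M _ v])

lemma polar_diff_right: "polar M v (w - u) = polar M v w - polar M v u"
  using polar_add_right[of M v "w - u" u] by simp

lemma polar_0: "polar M v 0 = 0" "polar M 0 v = 0"
  using polar_scale_right[of M v 0 0] polar_scale_left[of M 0 0 v] by auto

lemma qform_add: "qform M (v + w) = qform M v + qform M w + polar M v w"
  by (simp add: polar_def)

lemma polar_self: "polar M v v = 2 * qform M v"
proof -
  have "v + v = 2 *s v" by (simp add: vec_eq_iff)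
  then show ?thesis using qform_scale[of M 2 v] by (simp add: polar_def)
qed

lemmas polar_linear = polar_add_right polar_add_left polar_scale_right polar_scale_left polar_diff_right polar_0

definition cols :: "'k::field ^ 3 \<Rightarrow> 'k ^ 3 \<Rightarrow> 'k ^ 3 \<Rightarrow> 'k ^ 3 ^ 3" where
  "cols a b c = (\<chi> i j. if j = 1 then a $ i else if j = 2 then b $ i else c $ i)"

lemma cols_mult: "cols a b c *v x = x $ 1 *s a + x $ 2 *s b + x $ 3 *s c"
  by (simp add: vec_eq_iff cols_def matrix_vector_mult_def sum_3 mult.commute)

definition conic_vecs :: "'k::field set \<Rightarrow> ('k ^ 3) set" where
  "conic_vecs F = {vector [1, t, t\<^sup>2] | t. t \<in> F} \<union> {vector [0, 0, 1]}"

lemma vec3_eq_iff: "x = y \<longleftrightarrow> x $ 1 = y $ 1 \<and> x $ 2 = y $ 2 \<and> x $ 3 = y $ 3" for x y :: "'a ^ 3"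
  by (simp add: vec_eq_iff forall_3)

lemma conic_vecs_nonzero: "w \<in> conic_vecs F \<Longrightarrow> w \<noteq> 0"
  by (auto simp: conic_vecs_def vec3_eq_iff)

lemma vec3_standard_conic:
  fixes x :: "'k::field ^ 3"
  assumes "x \<noteq> 0" "x $ 1 * x $ 3 = (x $ 2)\<^sup>2"
  obtains c w where "c \<noteq> 0" "w \<in> conic_vecs UNIV" "x = c *s w"
    "w = vector [1, x $ 2 / x $ 1, (x $ 2 / x $ 1)\<^sup>2] \<or> w = vector [0, 0, 1]"
proof (cases "x $ 1 = 0")
  case True
  then show ?thesis
    using assms that[of "x $ 3" "vector [0, 0, 1]"] by (auto simp: conic_vecs_def vec3_eq_iff)
next
  case False
  then have "x = x $ 1 *s vector [1, x $ 2 / x $ 1, (x $ 2 / x $ 1)\<^sup>2]"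
    using assms by (simp add: vec3_eq_iff field_simps power2_eq_square)
  then show ?thesis
    using that[of "x $ 1" "vector [1, x $ 2 / x $ 1, (x $ 2 / x $ 1)\<^sup>2]"] False
    by (auto simp: conic_vecs_def)
qed

context cubic_extension
begin

lemma vecs_over_F_closed:
  "v \<in> vecs_over F \<Longrightarrow> w \<in> vecs_over F \<Longrightarrow> v + w \<in> vecs_over F"
  "v \<in> vecs_over F \<Longrightarrow> w \<in> vecs_over F \<Longrightarrow> v - w \<in> vecs_over F"
  "c \<in> F \<Longrightarrow> v \<in> vecs_over F \<Longrightarrow> c *s v \<in> vecs_over F"
  by (auto simp: vecs_over_def)

lemma polar_in_F: "\<forall>i j. M $ i $ j \<in> F \<Longrightarrow> v \<in> vecs_over F \<Longrightarrow> w \<in> vecs_over F \<Longrightarrow> polar M v w \<in> F"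
  unfolding polar_def by (intro F_closed qform_in_F vecs_over_F_closed) auto

text \<open>A normal form valid in every characteristic: a hyperbolic pair \<open>p\<close>,
  \<open>r\<close> and a vector \<open>m\<close> orthogonal to both. An isotropic \<open>p\<close>
  exists by Chevalley-Warning, and non-degeneracy supplies a vector over \<open>F\<close> that pairs
  with it.\<close>

lemma nondegenerate_conic_hyperbolic:
  assumes M: "\<forall>i j. M $ i $ j \<in> F"
    and nd: "\<not> (\<exists>v\<in>vecs_over F. v \<noteq> 0 \<and> qform M v = 0 \<and> (\<forall>w\<in>vecs_over F. polar M v w = 0))"
  obtains p m r :: "'k ^ 3" where "p \<in> vecs_over F" "m \<in> vecs_over F" "r \<in> vecs_over F"
    "invertible (cols p m r)"
    "qform M p = 0" "qform M r = 0" "qform M m \<noteq> 0"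
    "polar M p r = 1" "polar M p m = 0" "polar M r m = 0"
proof -
  obtain p where p: "p \<in> vecs_over F" "p \<noteq> 0" "qform M p = 0"
    using ternary_form_isotropic[OF M] by blast
  then obtain u where u: "u \<in> vecs_over F" "polar M p u \<noteq> 0" using nd by blast
  \<comment> \<open>Adding \<open>c *s p\<close> to \<open>u\<close> adds
    \<open>c * polar M p u\<close> to the value of the form, as \<open>p\<close> is isotropic; this
    multiple cancels \<open>qform M u\<close>.\<close>
  define r0 where "r0 = u - (qform M u / polar M p u) *s p"
  define r where "r = (1 / polar M p u) *s r0"
  note inF = qform_in_F[OF M] polar_in_F[OF M]
  have r0: "qform M r0 = 0" "polar M p r0 = polar M p u"
  proof -
    have "qform M r0 = qform M (u + (- (qform M u / polar M p u)) *s p)"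
      by (simp add: r0_def)
    also have "\<dots> = 0"
      using u p by (simp add: qform_add qform_scale polar_linear polar_commute[of M u p] del: vec.scale_minus_left vector_smult_lneg)
    finally show "qform M r0 = 0" .
    show "polar M p r0 = polar M p u" using p by (simp add: r0_def polar_linear polar_self)
  qed
  have rF: "r \<in> vecs_over F" unfolding r_def r0_def
    using p u by (intro vecs_over_F_closed F_closed inF) auto
  have r: "qform M r = 0" "polar M p r = 1"
    using u r0 by (auto simp: r_def qform_scale polar_linear)
  \<comment> \<open>A coordinate vector is chosen because it automatically lies over
    \<open>F\<close>.\<close>
  have "\<exists>i. axis i 1 \<notin> vec.span {p, r}"
  proof (rule ccontr)
    assume "\<not> ?thesis"
    then have "cart_basis \<subseteq> vec.span {p, r}" by (auto simp: cart_basis_def)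
    then have "vec.span (cart_basis :: ('k ^ 3) set) \<subseteq> vec.span {p, r}"
      by (rule vec.span_minimal) (rule vec.subspace_span)
    then have "(UNIV :: ('k ^ 3) set) \<subseteq> vec.span {p, r}" using span_cart_basis by blast
    then have "vec.dim (UNIV :: ('k ^ 3) set) \<le> card {p, r}" by (rule vec.dim_le_card) simp
    also have "\<dots> \<le> 2" by (simp add: card_insert_if)
    finally show False by (simp add: vec.dim_UNIV card_cart_basis)
  qed
  then obtain x :: "'k ^ 3" where x: "x \<notin> vec.span {p, r}" "x \<in> vecs_over F"
    by (auto simp: vecs_over_def axis_def)
  define m where "m = x - (polar M x r *s p + polar M x p *s r)"
  have mF: "m \<in> vecs_over F" unfolding m_def
    using p rF x by (intro vecs_over_F_closed F_closed inF) auto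
  have pm: "polar M p m = 0" "polar M r m = 0"
    using p r by (auto simp: m_def polar_linear polar_self polar_commute[of M r p] polar_commute[of M x p] polar_commute[of M x r])
  have m_span: "m \<notin> vec.span {p, r}"
  proof
    assume "m \<in> vec.span {p, r}"
    then have "m + (polar M x r *s p + polar M x p *s r) \<in> vec.span {p, r}"
      by (rule vec.span_add) (intro vec.span_add vec.span_scale vec.span_base; simp)
    moreover have "m + (polar M x r *s p + polar M x p *s r) = x" by (simp add: m_def)
    ultimately show False using x by metis
  qed
  have inv: "invertible (cols p m r)"
    unfolding invertible_iff_ker
  proof (intro allI impI)
    fix y :: "'k ^ 3" assume "cols p m r *v y = 0"
    then have e: "y $ 1 *s p + y $ 2 *s m + y $ 3 *s r = 0" by (simp add: cols_mult)
    have "polar M p (y $ 1 *s p + y $ 2 *s m + y $ 3 *s r) = 0"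
      "polar M r (y $ 1 *s p + y $ 2 *s m + y $ 3 *s r) = 0" by (simp_all only: e polar_0)
    then have "y $ 3 = 0" "y $ 1 = 0"
      using p r pm by (simp_all add: polar_linear polar_self polar_commute[of M r p])
    moreover have "m \<noteq> 0" using m_span by (auto simp: vec.span_zero)
    ultimately show "y = 0" using e by (auto simp: vec3_eq_iff)
  qed
  \<comment> \<open>Otherwise \<open>m\<close> pairs to 0 with \<open>p\<close>, with
    \<open>r\<close> and, since \<open>polar M m m\<close> is twice the form, with itself, and so is
    singular.\<close>
  have "qform M m \<noteq> 0"
  proof
    assume m0: "qform M m = 0"
    have "polar M m w = 0" for w
    proof -
      obtain y where "w = cols p m r *v y"
        using inv by (rule invertible_surjE)
      then show ?thesis using pm m0
        by (simp add: cols_mult polar_linear polar_self polar_commute[of M m p] polar_commute[of M m r])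
    qed
    moreover have "m \<noteq> 0" using m_span by (auto simp: vec.span_zero)
    ultimately show False using nd mF m0 by blast
  qed
  then show ?thesis by (rule that[OF p(1) mF rF inv p(3) r(1) _ r(2) pm])
qed

lemma nondegenerate_conic_param:
  assumes "nondegenerate_conic F D"
  obtains N :: "'k ^ 3 ^ 3" where "\<forall>i j. N $ i $ j \<in> F" "invertible N"
    "D = (\<lambda>w. vec.span {N *v w}) ` conic_vecs F"
proof -
  obtain M where M: "\<forall>i j. M $ i $ j \<in> F"
    and nd: "\<not> (\<exists>v\<in>vecs_over F. v \<noteq> 0 \<and> qform M v = 0 \<and> (\<forall>w\<in>vecs_over F. polar M v w = 0))"
    and D: "D = {vec.span {v} | v. v \<in> vecs_over F \<and> v \<noteq> 0 \<and> qform M v = 0}"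
    using assms unfolding nondegenerate_conic_def by blast
  obtain p m r where pmr: "p \<in> vecs_over F" "m \<in> vecs_over F" "r \<in> vecs_over F"
    "invertible (cols p m r)"
    "qform M p = 0" "qform M r = 0" "qform M m \<noteq> 0"
    "polar M p r = 1" "polar M p m = 0" "polar M r m = 0"
    by (rule nondegenerate_conic_hyperbolic[OF M nd])
  define \<delta> where "\<delta> = qform M m"
  have \<delta>: "\<delta> \<noteq> 0" "\<delta> \<in> F" using pmr qform_in_F[OF M] by (auto simp: \<delta>_def)
  \<comment> \<open>On the basis \<open>p\<close>, \<open>m\<close>, \<open>r\<close> the form is
    \<delta> * y2^2 + y1 * y3. Rescaling \<open>r\<close> by - \<delta> turns it into \<delta> times
    the standard y2^2 - y1 * y3.\<close>
  define N where "N = cols p m ((- \<delta>) *s r)"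
  have NF: "\<forall>i j. N $ i $ j \<in> F"
    using pmr \<delta> by (auto simp: N_def cols_def vecs_over_def)
  have N_mult: "N *v y = cols p m r *v vector [y $ 1, y $ 2, - \<delta> * y $ 3]" for y
    by (simp add: N_def cols_mult mult.commute)
  have inv: "invertible N"
    unfolding invertible_iff_ker
  proof (intro allI impI)
    fix y assume "N *v y = 0"
    then have "vector [y $ 1, y $ 2, - \<delta> * y $ 3] = (0 :: 'k ^ 3)"
      using pmr(4) unfolding invertible_iff_ker N_mult by blast
    then show "y = 0" using \<delta> by (simp add: vec3_eq_iff)
  qed
  have Q: "qform M (N *v y) = \<delta> * ((y $ 2)\<^sup>2 - y $ 1 * y $ 3)" for y
  proof -
    define z where "z = - \<delta> * y $ 3"
    have "N *v y = y $ 1 *s p + y $ 2 *s m + z *s r" by (simp add: N_mult cols_mult z_def)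
    then have "qform M (N *v y) = (y $ 2)\<^sup>2 * \<delta> + z * y $ 1"
      using pmr by (simp add: qform_add qform_scale polar_linear polar_commute[of M m r] flip: \<delta>_def)
    then show ?thesis by (simp add: z_def algebra_simps)
  qed
  \<comment> \<open>Pairing with \<open>p\<close> and \<open>r\<close> recovers y3 and y1. Pairing
    with \<open>m\<close> gives only 2 * \<delta> * y2, which is 0 in characteristic 2, so y2 is
    read off a nonzero entry of \<open>m\<close> instead.\<close>
  have F_coords: "y \<in> vecs_over F" if "N *v y \<in> vecs_over F" for y
  proof -
    have "polar M p (N *v y) \<in> F" "polar M r (N *v y) \<in> F"
      using that pmr by (auto intro: polar_in_F[OF M])
    then have "- (y $ 3 * \<delta>) \<in> F" "y $ 1 \<in> F"
      using pmr
      by (auto simp: N_def cols_mult polar_linear polar_self polar_commute[of M r p] mult.commute[of \<delta>])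
    then have 13: "y $ 3 \<in> F" "y $ 1 \<in> F"
      using \<delta> F_closed(8)[of "- (y $ 3 * \<delta>)" "- \<delta>"] by auto
    have "m \<noteq> 0" using \<delta> by (auto simp: \<delta>_def qform_def)
    then obtain i where i: "m $ i \<noteq> 0" by (auto simp: vec_eq_iff)
    have "y $ 2 * m $ i = (N *v y) $ i - y $ 1 * p $ i + y $ 3 * \<delta> * r $ i"
      by (simp add: N_def cols_mult algebra_simps)
    also have "\<dots> \<in> F" using that 13 \<delta> pmr by (auto simp: vecs_over_def)
    finally have "y $ 2 \<in> F"
      using i pmr F_closed(8)[of "y $ 2 * m $ i" "m $ i"] by (auto simp: vecs_over_def)
    with 13 show ?thesis by (simp add: vecs_over_def forall_3)
  qed
  have N_F: "N *v y \<in> vecs_over F" if "y \<in> vecs_over F" for y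
    using NF that unfolding vecs_over_def matrix_vector_mult_def
    by (auto intro!: F_sum)
  have "D = (\<lambda>w. vec.span {N *v w}) ` conic_vecs F"
  proof (intro equalityI subsetI)
    fix P assume "P \<in> D"
    then obtain v where v: "v \<in> vecs_over F" "v \<noteq> 0" "qform M v = 0" "P = vec.span {v}"
      using D by blast
    obtain y where y: "v = N *v y"
      using inv by (rule invertible_surjE)
    have "y \<noteq> 0" "y $ 1 * y $ 3 = (y $ 2)\<^sup>2" using v y Q[of y] \<delta> by auto
    then obtain c w where cw: "c \<noteq> 0" "y = c *s w"
      "w = vector [1, y $ 2 / y $ 1, (y $ 2 / y $ 1)\<^sup>2] \<or> w = vector [0, 0, 1]"
      using vec3_standard_conic by metis
    have "y $ 2 / y $ 1 \<in> F" using F_coords v y by (auto simp: vecs_over_def)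
    then have "w \<in> conic_vecs F" using cw(3) by (auto simp: conic_vecs_def)
    moreover have "P = vec.span {N *v w}" using v y cw by (simp add: vec.scale span_singleton_scale)
    ultimately show "P \<in> (\<lambda>w. vec.span {N *v w}) ` conic_vecs F" by blast
  next
    fix P assume "P \<in> (\<lambda>w. vec.span {N *v w}) ` conic_vecs F"
    then obtain w where w: "w \<in> conic_vecs F" "P = vec.span {N *v w}" by blast
    then have "w \<in> vecs_over F" "qform M (N *v w) = 0"
      by (auto simp: conic_vecs_def vecs_over_def forall_3 Q)
    moreover have "N *v w \<noteq> 0"
      using inv conic_vecs_nonzero[OF w(1)] by (auto simp: invertible_iff_ker)
    ultimately show "P \<in> D" using N_F w D by blast
  qed
  then show ?thesis using that NF inv by blast
qed

text \<open>On the parametrised conic the equation of \<open>C'\<close> becomes a quartic in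
  \<open>t\<close> that vanishes on the q elements of \<open>F\<close>. As q > 4, all five
  coefficients vanish, which leaves a multiple of y1 * y3 - y2^2.\<close>

lemma conic_extension:
  fixes M :: "'k ^ 3 ^ 3"
  assumes "nondegenerate_conic UNIV C'" "q > 4" "invertible M"
    and sub: "(\<lambda>w. vec.span {M *v w}) ` conic_vecs F \<subseteq> C'"
  shows "C' = (\<lambda>w. vec.span {M *v w}) ` conic_vecs UNIV"
proof -
  obtain M' where nd: "\<not> (\<exists>v. v \<noteq> 0 \<and> qform M' v = 0 \<and> (\<forall>w. polar M' v w = 0))"
    and C': "C' = {vec.span {v} | v. v \<noteq> 0 \<and> qform M' v = 0}"
    using assms(1) by (auto simp: nondegenerate_conic_def vecs_over_def)
  define a b c where abc: "a = column 1 M" "b = column 2 M" "c = column 3 M"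
  have M_mult: "M *v x = x $ 1 *s a + x $ 2 *s b + x $ 3 *s c" for x
    by (simp add: abc vec_eq_iff matrix_vector_mult_def sum_3 column_def mult.commute)
  have Q: "qform M' (M *v x) = (x $ 1)\<^sup>2 * qform M' a + (x $ 2)\<^sup>2 * qform M' b + (x $ 3)\<^sup>2 * qform M' c
      + x $ 1 * x $ 2 * polar M' a b + x $ 1 * x $ 3 * polar M' a c + x $ 2 * x $ 3 * polar M' b c" for x
    by (simp add: M_mult qform_add qform_scale polar_linear algebra_simps)
  let ?p = "[:qform M' a, polar M' a b, qform M' b + polar M' a c, polar M' b c, qform M' c:]"
  have "poly ?p t = 0" if "t \<in> F" for t
  proof -
    let ?w = "vector [1, t, t\<^sup>2] :: 'k ^ 3"
    have "vec.span {M *v ?w} \<in> C'" using sub that by (auto simp: conic_vecs_def)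
    then obtain v where v: "vec.span {M *v ?w} = vec.span {v}" "qform M' v = 0" using C' by blast
    then have "M *v ?w \<in> vec.span {v}" using vec.span_base[of "M *v ?w" "{M *v ?w}"] by simp
    then have "qform M' (M *v ?w) = 0" using v(2) by (auto simp: vec.span_singleton qform_scale)
    then show ?thesis unfolding Q by (simp add: algebra_simps power2_eq_square)
  qed
  then have "card F \<le> card {t. poly ?p t = 0}" by (intro card_mono) auto
  moreover have "card {t. poly ?p t = 0} \<le> degree ?p" if "?p \<noteq> 0"
    using that by (rule card_poly_roots_bound)
  moreover have "degree ?p \<le> 4" by (simp add: degree_pCons_eq_if)
  ultimately have "?p = 0" using assms(2) card_F by linarith
  then have p0: "qform M' a = 0" "polar M' a b = 0" "qform M' b + polar M' a c = 0"
    "polar M' b c = 0" "qform M' c = 0" by (simp_all only: pCons_eq_0_iff)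
  then have "qform M' b = - polar M' a c" by (simp only: eq_neg_iff_add_eq_0)
  then have Q': "qform M' (M *v x) = polar M' a c * (x $ 1 * x $ 3 - (x $ 2)\<^sup>2)" for x
    unfolding Q by (simp add: p0 algebra_simps)
  \<comment> \<open>With factor 0 the form would vanish identically and every point would be
    singular.\<close>
  have nz: "polar M' a c \<noteq> 0"
  proof
    assume "polar M' a c = 0"
    have 0: "qform M' v = 0" for v
    proof -
      obtain x where "v = M *v x" using assms(3) by (rule invertible_surjE)
      then show ?thesis using Q' \<open>polar M' a c = 0\<close> by simp
    qed
    then have "polar M' v w = 0" for v w by (simp add: polar_def)
    moreover have "(axis 1 1 :: 'k ^ 3) \<noteq> 0" by simp
    ultimately show False using nd 0 by blast
  qed
  show ?thesis
  proof (intro equalityI subsetI)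
    fix P assume "P \<in> C'"
    then obtain v where v: "v \<noteq> 0" "qform M' v = 0" "P = vec.span {v}" using C' by blast
    obtain x where x: "v = M *v x" using assms(3) by (rule invertible_surjE)
    then have "x \<noteq> 0" "x $ 1 * x $ 3 = (x $ 2)\<^sup>2" using v Q'[of x] nz by auto
    then obtain c w where cw: "c \<noteq> 0" "w \<in> conic_vecs UNIV" "x = c *s w"
      using vec3_standard_conic by metis
    then have "P = vec.span {M *v w}" using v x by (simp add: vec.scale span_singleton_scale)
    then show "P \<in> (\<lambda>w. vec.span {M *v w}) ` conic_vecs UNIV" using cw by blast
  next
    fix P assume "P \<in> (\<lambda>w. vec.span {M *v w}) ` conic_vecs UNIV"
    then obtain w where w: "w \<in> conic_vecs UNIV" "P = vec.span {M *v w}" by blast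
    then have "qform M' (M *v w) = 0" by (auto simp: conic_vecs_def Q')
    moreover have "M *v w \<noteq> 0"
      using assms(3) conic_vecs_nonzero[OF w(1)] by (auto simp: invertible_iff_ker)
    ultimately show "P \<in> C'" using w C' by blast
  qed
qed

end

section \<open>Indices modulo 3, spans and independence of families\<close>

lemma pts_eq: "vec.subspace W \<Longrightarrow> pts W = {vec.span {v} | v. v \<noteq> 0 \<and> v \<in> W}"
proof -
  assume W: "vec.subspace W"
  have "vec.span {v} \<subseteq> W \<longleftrightarrow> v \<in> W" for v
    using vec.span_minimal[of "{v}" W] vec.span_base[of v "{v}"] W by blast
  then show ?thesis by (auto simp: pts_def PG_def vecs_over_def)
qed

text \<open>Conjugates are indexed by natural numbers with laws of period 3. Statements invariant
  under a shift by 3 need checking only for three indices.\<close>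

lemma nat_mod_3_induct [case_names 0 1 2 step]:
  "P 0 \<Longrightarrow> P 1 \<Longrightarrow> P 2 \<Longrightarrow> (\<And>n. P n \<Longrightarrow> P (n + 3)) \<Longrightarrow> P (n :: nat)"
proof -
  assume P: "P 0" "P 1" "P 2" and step: "\<And>n. P n \<Longrightarrow> P (n + 3)"
  have "P (3 * k + m)" if "P m" for k m
  proof (induction k)
    case (Suc k)
    then show ?case using step[of "3 * k + m"] by (simp add: add_ac)
  qed (use that in simp)
  moreover have "n mod 3 = 0 \<or> n mod 3 = 1 \<or> n mod 3 = 2" by linarith
  ultimately show "P n" using P by (metis mult_div_mod_eq)
qed

text \<open>Sums that reach 3 are kept as a remainder plus 3, the shape that laws such as
  \<open>E_add3\<close> rewrite.\<close>

lemma index_add: "0 + 1 = (1 :: nat)" "0 + 2 = (2 :: nat)" "1 + 1 = (2 :: nat)"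
  "1 + 2 = 0 + (3 :: nat)" "2 + 1 = 0 + (3 :: nat)" "2 + 2 = 1 + (3 :: nat)"
  by simp_all

lemma span_insert3: "vec.span {u, v, w} = {a *s u + b *s v + c *s w | a b c. True}"
proof (intro equalityI subsetI)
  fix x assume "x \<in> vec.span {u, v, w}"
  then obtain a b c where "x - a *s u - b *s v = c *s w"
    by (auto simp: vec.span_insert vec.span_singleton)
  then have "x = a *s u + b *s v + c *s w" by (simp add: algebra_simps)
  then show "x \<in> {a *s u + b *s v + c *s w | a b c. True}" by blast
next
  fix x assume "x \<in> {a *s u + b *s v + c *s w | a b c. True}"
  then show "x \<in> vec.span {u, v, w}"
    by (auto intro!: vec.span_add vec.span_scale intro: vec.span_base)
qed

lemma independent_family:
  fixes b :: "nat \<Rightarrow> 'k::field ^ 'n"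
  assumes "\<And>c i. (\<Sum>i\<le>r. c i *s b i) = 0 \<Longrightarrow> i \<le> r \<Longrightarrow> c i = 0"
  shows "inj_on b {..r}" "vec.independent (b ` {..r})"
proof -
  show inj: "inj_on b {..r}"
  proof (rule inj_onI, rule ccontr)
    fix i j assume ij: "i \<in> {..r}" "j \<in> {..r}" "b i = b j" "i \<noteq> j"
    let ?c = "\<lambda>l. if l = i then 1 else if l = j then - 1 else 0 :: 'k"
    have "(\<Sum>l\<le>r. ?c l *s b l) = (\<Sum>l\<in>{i, j}. ?c l *s b l)"
      by (rule sum.mono_neutral_right) (use ij in auto)
    also have "\<dots> = 0" using ij by simp
    finally show False using assms[of ?c i] ij by simp
  qed
  show "vec.independent (b ` {..r})"
  proof (rule vec.independent_if_scalars_zero)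
    fix f x assume "(\<Sum>x\<in>b ` {..r}. f x *s x) = 0" "x \<in> b ` {..r}"
    then show "f x = 0" using assms[of "\<lambda>i. f (b i)"] by (auto simp: sum.reindex[OF inj])
  qed simp
qed

lemma poly_eq_sum_atMost:
  fixes p :: "'a::comm_semiring_1 poly"
  assumes "degree p \<le> r"
  shows "poly p t = (\<Sum>i\<le>r. coeff p i * t ^ i)"
  unfolding poly_altdef using assms
  by (intro sum.mono_neutral_left) (auto simp: coeff_eq_0)

lemma degree_le_2E:
  fixes h :: "'a::zero poly"
  assumes "degree h \<le> 2"
  obtains a b c where "h = [:a, b, c:]"
proof -
  have "h = [:coeff h 0, coeff h 1, coeff h 2:]"
    using assms by (intro poly_eqI) (auto simp: coeff_pCons coeff_eq_0 numeral_2_eq_2 split: nat.splits)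
  then show ?thesis by (rule that)
qed

section \<open>Scroll-planes and the six-space\<close>

text \<open>Bezout's relation; the library's \<open>coprime\<close> yields it only over rings with a gcd.\<close>

definition comaximal :: "'a::comm_ring_1 \<Rightarrow> 'a \<Rightarrow> bool" where
  "comaximal a b \<longleftrightarrow> (\<exists>u v. u * a + v * b = 1)"

lemma comaximal_mult_right:
  assumes "comaximal a b" "comaximal a c"
  shows "comaximal a (b * c)"
proof -
  obtain u v u' v' where "u * a + v * b = 1" "u' * a + v' * c = 1"
    using assms by (auto simp: comaximal_def)
  then have "(u * a + v * b) * (u' * a + v' * c) = 1" by simp
  then have "(u * u' * a + u * v' * c + v * b * u') * a + (v * v') * (b * c) = 1"
    by (simp add: algebra_simps)
  then show ?thesis unfolding comaximal_def by blast
qed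

lemma comaximal_commute: "comaximal a b \<longleftrightarrow> comaximal b a"
  unfolding comaximal_def by (metis add.commute)

lemma comaximal_dvd_mult:
  assumes "comaximal a b" "a dvd c" "b dvd c"
  shows "a * b dvd c"
proof -
  obtain u v where uv: "u * a + v * b = 1" using assms by (auto simp: comaximal_def)
  obtain x where "c = a * x" using assms by blast
  moreover obtain y where "c = b * y" using assms by blast
  ultimately have "c * (u * a + v * b) = a * b * (u * y + v * x)" by (simp add: algebra_simps)
  then show ?thesis using uv by simp
qed

text \<open>A nonzero combination of \<open>a\<close> and \<open>b\<close> of least degree divides
  every other combination, because the remainder is again a combination. By hypothesis this common
  divisor is a constant.\<close>

lemma poly_comaximalI:
  fixes a b :: "'a::field poly"
  assumes "a \<noteq> 0" and nd: "\<And>d. d dvd a \<Longrightarrow> d dvd b \<Longrightarrow> degree d = 0"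
  shows "comaximal a b"
proof -
  let ?P = "\<lambda>d. d \<noteq> 0 \<and> (\<exists>u v. d = u * a + v * b)"
  have "?P a" using assms(1) by (auto intro: exI[of _ 1] exI[of _ 0])
  then obtain d where d: "?P d" and min: "\<And>e. ?P e \<Longrightarrow> degree d \<le> degree e"
    using ex_has_least_nat[of ?P a degree] by blast
  then obtain u v where uv: "d = u * a + v * b" by blast
  have dvd: "d dvd x * a + y * b" for x y
  proof (rule ccontr)
    assume "\<not> ?thesis"
    then have 0: "(x * a + y * b) mod d \<noteq> 0" by (simp add: mod_eq_0_iff_dvd)
    let ?k = "(x * a + y * b) div d"
    have "(x * a + y * b) mod d = x * a + y * b - ?k * d" by (simp add: minus_div_mult_eq_mod)
    also have "\<dots> = (x - ?k * u) * a + (y - ?k * v) * b"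
      by (subst (2) uv) (simp add: algebra_simps)
    finally have "?P ((x * a + y * b) mod d)" using 0 by blast
    then show False using min degree_mod_less'[of d "x * a + y * b"] 0 d by fastforce
  qed
  have "d dvd a" "d dvd b" using dvd[of 1 0] dvd[of 0 1] by simp_all
  then have "degree d = 0" using nd by blast
  then obtain c where c: "d = [:c:]" "c \<noteq> 0" using d by (metis degree_eq_zeroE pCons_0_0)
  have "smult (1 / c) u * a + smult (1 / c) v * b = smult (1 / c) d"
    by (simp add: uv smult_add_right)
  also have "\<dots> = 1" using c by (simp add: one_pCons)
  finally show ?thesis unfolding comaximal_def by blast
qed

context cubic_extension
begin

definition cpoly :: "'k poly \<Rightarrow> 'k poly" where
  "cpoly = map_poly (\<lambda>x. x ^ q)"

lemma coeff_cpoly: "coeff (cpoly p) i = coeff p i ^ q"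
  unfolding cpoly_def by (rule coeff_map_poly) (use q_pos in \<open>simp add: power_0_left\<close>)

lemma cpoly_simps [simp]:
  "cpoly 0 = 0" "cpoly 1 = 1" "cpoly (pCons a p) = pCons (a ^ q) (cpoly p)"
  "cpoly (p + r) = cpoly p + cpoly r" "cpoly (p * r) = cpoly p * cpoly r"
  "cpoly (smult a p) = smult (a ^ q) (cpoly p)"
  using q_pos
  by (auto intro!: poly_eqI simp: coeff_cpoly coeff_pCons coeff_1 power_0_left power_q_add coeff_mult
      power_q_sum power_mult_distrib split: nat.splits)

lemma poly_cpoly: "poly (cpoly p) (x ^ q) = poly p x ^ q"
  by (induction p) (auto simp: power_q_add power_mult_distrib power_0_left q_pos)

lemma comaximal_cpoly: "comaximal a b \<Longrightarrow> comaximal (cpoly a) (cpoly b)"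
  unfolding comaximal_def by (metis cpoly_simps(2,4,5))

text \<open>Only the coefficients are conjugated, so the form stays linear in \<open>x\<close>;
  conjugating \<open>x\<close> too conjugates the value, as \<open>lin_form_frob\<close>
  records.\<close>

definition lin_form :: "'k ^ 3 \<Rightarrow> nat \<Rightarrow> 'k ^ 3 \<Rightarrow> 'k" where
  "lin_form \<alpha> j x = (\<Sum>i\<in>UNIV. (\<alpha> $ i) ^ (q ^ j) * x $ i)"

lemma lin_form_linear:
  "lin_form \<alpha> j (x + y) = lin_form \<alpha> j x + lin_form \<alpha> j y"
  "lin_form \<alpha> j (c *s x) = c * lin_form \<alpha> j x" "lin_form \<alpha> j 0 = 0"
  by (simp_all add: lin_form_def algebra_simps sum.distrib sum_distrib_left)

lemma lin_form_add3: "lin_form \<alpha> (j + 3) x = lin_form \<alpha> j x"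
  by (simp add: lin_form_def power_add power_mult power_q3)

lemma lin_form_frob: "lin_form \<alpha> (Suc j) (frob q x) = lin_form \<alpha> j x ^ q"
  by (simp add: lin_form_def frob_def power_q_sum power_mult_distrib mult.commute[of q] power_mult)

end

text \<open>The geometry reduced to algebra: the zeros of \<open>lin_form \<alpha> 0\<close> are the
  line at infinity, \<open>\<alpha>_indep\<close> says that the subplane is exterior to it, and
  \<open>H\<close> is the extended six-space.\<close>

locale conic_scroll = cubic_extension q K for q :: nat and K :: "'k::{field,finite} itself" +
  fixes E :: "nat \<Rightarrow> 'k ^ 3 \<Rightarrow> 'k ^ 9" and \<alpha> :: "'k ^ 3" and H :: "('k ^ 9) set"
  assumes E_add: "E j (x + y) = E j x + E j y" and E_scale: "E j (c *s x) = c *s E j x"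
    and E_indep: "E 0 x + E 1 y + E 2 z = 0 \<Longrightarrow> x = 0 \<and> y = 0 \<and> z = 0"
    and E_frob: "frob q (E j x) = E (Suc j) (frob q x)"
    and E_add3: "E (j + 3) = E j"
    and subspace_H: "vec.subspace H"
    and H_iff: "E 0 x + E 1 y + E 2 z \<in> H \<longleftrightarrow>
      lin_form \<alpha> 0 x = lin_form \<alpha> 1 y \<and> lin_form \<alpha> 1 y = lin_form \<alpha> 2 z"
    and \<alpha>_indep: "x \<in> vecs_over F \<Longrightarrow> lin_form \<alpha> 0 x = 0 \<Longrightarrow> x = 0"
begin

lemma E_0: "E j 0 = 0"
  using E_scale[of j 0 0] by simp

lemma E_sum: "(\<Sum>i\<in>A. E j (f i)) = E j (\<Sum>i\<in>A. f i)"
  by (induction A rule: infinite_finite_induct) (simp_all add: E_0 E_add)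

lemma E_linear: "Vector_Spaces.linear (*s) (*s) (E j)"
  by unfold_locales (simp_all add: E_add E_scale)

lemma E_shift_add3: "E (i + 3) = E i" "E (i + 3 + 1) = E (i + 1)" "E (i + 3 + 2) = E (i + 2)"
  using E_add3[of i] E_add3[of "i + 1"] E_add3[of "i + 2"] by (simp_all add: add_ac)

lemma lin_form_shift_add3: "lin_form \<alpha> (i + 3) = lin_form \<alpha> i"
  "lin_form \<alpha> (i + 3 + 1) = lin_form \<alpha> (i + 1)" "lin_form \<alpha> (i + 3 + 2) = lin_form \<alpha> (i + 2)"
  using lin_form_add3[of \<alpha> i] lin_form_add3[of \<alpha> "i + 1"] lin_form_add3[of \<alpha> "i + 2"]
  by (auto simp: add_ac)

lemma E_index: "E (0 + 1) = E 1" "E (0 + 2) = E 2" "E (1 + 1) = E 2" "E (1 + 2) = E 0"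
  "E (2 + 1) = E 0" "E (2 + 2) = E 1"
  by (simp_all only: index_add E_add3)

lemma lin_form_index: "lin_form \<alpha> (0 + 1) = lin_form \<alpha> 1" "lin_form \<alpha> (0 + 2) = lin_form \<alpha> 2"
  "lin_form \<alpha> (1 + 1) = lin_form \<alpha> 2" "lin_form \<alpha> (1 + 2) = lin_form \<alpha> 0"
  "lin_form \<alpha> (2 + 1) = lin_form \<alpha> 0" "lin_form \<alpha> (2 + 2) = lin_form \<alpha> 1"
  by (simp_all only: index_add lin_form_add3 fun_eq_iff simp_thms)

lemma rotate_sum: "E 1 x + E 2 y + E 0 z = E 0 z + E 1 x + E 2 y" "E 2 x + E 0 y + E 1 z = E 0 y + E 1 z + E 2 x"
  by (simp_all add: add_ac)

text \<open>The cyclic symmetry of the three planes; it allows the three conjugate roots to be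
  treated by one argument with a general index \<open>i\<close>.\<close>

lemma E_indep_shift: "E i x + E (i + 1) y + E (i + 2) z = 0 \<Longrightarrow> x = 0 \<and> y = 0 \<and> z = 0"
proof (induction i rule: nat_mod_3_induct)
  case 0 then show ?case using E_indep[of x y z] unfolding E_index by blast
next
  case 1 then show ?case using E_indep[of z x y] unfolding E_index rotate_sum by blast
next
  case 2 then show ?case using E_indep[of y z x] unfolding E_index rotate_sum by blast
next
  case (step n) then show ?case by (simp only: E_shift_add3)
qed

lemma H_iff_shift: "E i x + E (i + 1) y + E (i + 2) z \<in> H \<longleftrightarrow>
    lin_form \<alpha> i x = lin_form \<alpha> (i + 1) y \<and> lin_form \<alpha> (i + 1) y = lin_form \<alpha> (i + 2) z"
proof (induction i rule: nat_mod_3_induct)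
  case 0 then show ?case unfolding E_index lin_form_index by (rule H_iff)
next
  case 1 then show ?case unfolding E_index lin_form_index rotate_sum H_iff by metis
next
  case 2 then show ?case unfolding E_index lin_form_index rotate_sum H_iff by metis
next
  case (step n) then show ?case by (simp only: E_shift_add3 lin_form_shift_add3)
qed

definition scroll :: "'k ^ 3 \<Rightarrow> ('k ^ 9) set" where
  "scroll w = vec.span {E 0 w, E 1 w, E 2 w}"

lemma scroll_shift: "scroll w = vec.span {E i w, E (i + 1) w, E (i + 2) w}"
proof (induction i rule: nat_mod_3_induct)
  case 0 show ?case unfolding E_index scroll_def ..
next
  case 1 show ?case unfolding E_index scroll_def by (simp add: insert_commute)
next
  case 2 show ?case unfolding E_index scroll_def by (simp add: insert_commute)
next
  case (step n) then show ?case by (simp only: E_shift_add3)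
qed

lemma scroll_eq: "scroll w = {E i (a *s w) + E (i + 1) (b *s w) + E (i + 2) (c *s w) | a b c. True}"
  unfolding scroll_shift[of w i] span_insert3 E_scale ..

text \<open>The polynomial \<open>f j\<close> of the overview: its value at \<open>t\<close> is that
  of \<open>lin_form \<alpha> j\<close> at \<open>ver t\<close>, and its coefficient of degree 2 is
  the value at \<open>ver_inf\<close>.\<close>

definition fp :: "nat \<Rightarrow> 'k poly" where
  "fp j = [:(\<alpha> $ 1) ^ (q ^ j), (\<alpha> $ 2) ^ (q ^ j), (\<alpha> $ 3) ^ (q ^ j):]"

lemma fp_add3: "fp (j + 3) = fp j"
  by (simp add: fp_def power_add power_mult power_q3)

lemma fp_Suc: "fp (Suc j) = cpoly (fp j)"
  by (simp add: fp_def mult.commute[of q] power_mult)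

definition ver :: "'k \<Rightarrow> 'k ^ 3" where "ver t = vector [1, t, t\<^sup>2]"
definition ver_inf :: "'k ^ 3" where "ver_inf = vector [0, 0, 1]"

lemma conic_vecs_eq: "conic_vecs U = ver ` U \<union> {ver_inf}"
  by (auto simp: conic_vecs_def ver_def ver_inf_def)

lemma ver_nonzero [simp]: "ver t \<noteq> 0" "ver_inf \<noteq> 0"
  by (simp_all add: ver_def ver_inf_def vec3_eq_iff)

lemma lin_form_ver: "lin_form \<alpha> j (ver t) = poly (fp j) t"
  by (simp add: lin_form_def sum_3 ver_def fp_def power2_eq_square algebra_simps)

lemma lin_form_ver_inf: "lin_form \<alpha> j ver_inf = coeff (fp j) 2"
  by (simp add: lin_form_def sum_3 ver_inf_def fp_def numeral_2_eq_2)

text \<open>The subplane point \<open>ver_inf\<close> is not at infinity. Consequently all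
  \<open>fp j\<close> have degree exactly 2.\<close>

lemma \<alpha>3_nonzero: "\<alpha> $ 3 \<noteq> 0"
proof
  assume "\<alpha> $ 3 = 0"
  then have "lin_form \<alpha> 0 ver_inf = 0" by (simp add: lin_form_ver_inf fp_def numeral_2_eq_2)
  moreover have "ver_inf \<in> vecs_over F" by (simp add: vecs_over_def ver_inf_def forall_3)
  ultimately show False using \<alpha>_indep ver_nonzero by blast
qed

lemma degree_fp: "degree (fp j) = 2" "fp j \<noteq> 0"
  using \<alpha>3_nonzero by (simp_all add: fp_def)

text \<open>For \<open>t\<close> in \<open>F\<close> the values for different \<open>j\<close> are
  conjugate, and the one for \<open>j = 0\<close> is the form at a subplane point.\<close>

lemma poly_fp_nonzero: "t \<in> F \<Longrightarrow> poly (fp j) t \<noteq> 0"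
proof -
  assume t: "t \<in> F"
  have "poly (fp j) t = poly (fp 0) t ^ (q ^ j)"
    using t by (simp add: fp_def power_qj_add power_mult_distrib F_power_qj)
  moreover have "poly (fp 0) t \<noteq> 0"
  proof
    assume "poly (fp 0) t = 0"
    then have "lin_form \<alpha> 0 (ver t) = 0" by (simp add: lin_form_ver)
    moreover have "ver t \<in> vecs_over F" using t by (simp add: vecs_over_def ver_def forall_3)
    ultimately show False using \<alpha>_indep ver_nonzero by blast
  qed
  ultimately show ?thesis by simp
qed

text \<open>If no form vanishes at \<open>w\<close>, the equations of \<open>H\<close> determine the
  three coefficients in the plane of \<open>w\<close> up to the common value of the forms. The
  solution \<open>y\<close> and its value \<nu> are left general, so that polynomial values and
  leading coefficients can both be inserted.\<close>

lemma pts_scroll_H: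
  assumes "w \<noteq> 0" "\<nu> \<noteq> 0" and y: "\<And>j. y j * lin_form \<alpha> j w = \<nu>"
  shows "pts (scroll w) \<inter> pts H = {vec.span {\<Sum>j<3. E j (y j *s w)}}"
proof -
  let ?u = "\<Sum>j<3. E j (y j *s w)"
  have u_eq: "?u = E 0 (y 0 *s w) + E 1 (y 1 *s w) + E 2 (y 2 *s w)"
    by (simp add: numeral_3_eq_3 numeral_2_eq_2)
  have sub: "vec.subspace (scroll w)" unfolding scroll_def by (rule vec.subspace_span)
  have nz: "y j \<noteq> 0" "lin_form \<alpha> j w \<noteq> 0" for j using y[of j] assms(2) by auto
  have u: "?u \<noteq> 0" "?u \<in> scroll w" "?u \<in> H"
  proof -
    show "?u \<noteq> 0"
      unfolding u_eq using E_indep[of "y 0 *s w" "y 1 *s w" "y 2 *s w"] assms(1) nz(1)[of 0] by auto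
    show "?u \<in> scroll w" unfolding u_eq scroll_eq[of w 0, unfolded E_index] by blast
    show "?u \<in> H" unfolding u_eq H_iff by (simp add: lin_form_linear y)
  qed
  have v: "vec.span {v} = vec.span {?u}" if v: "v \<noteq> 0" "v \<in> scroll w" "v \<in> H" for v
  proof -
    obtain a b c where abc: "v = E 0 (a *s w) + E 1 (b *s w) + E 2 (c *s w)"
      using v(2) unfolding scroll_eq[of w 0, unfolded E_index] by blast
    define \<kappa> where "\<kappa> = a * lin_form \<alpha> 0 w"
    have "b * lin_form \<alpha> 1 w = \<kappa>" "c * lin_form \<alpha> 2 w = \<kappa>"
      using v(3) unfolding abc H_iff by (auto simp: lin_form_linear \<kappa>_def numeral_2_eq_2)
    moreover have "x = (\<kappa> / \<nu>) * y j" if "x * lin_form \<alpha> j w = \<kappa>" for x j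
      unfolding that[symmetric] y[of j, symmetric] using nz[of j] by simp
    ultimately have e: "a = (\<kappa> / \<nu>) * y 0" "b = (\<kappa> / \<nu>) * y 1" "c = (\<kappa> / \<nu>) * y 2"
      unfolding \<kappa>_def by blast+
    have "v = (\<kappa> / \<nu>) *s ?u"
      unfolding u_eq abc by (simp add: e E_scale vec.scale_right_distrib)
    moreover from this have "\<kappa> / \<nu> \<noteq> 0" using v(1) by auto
    ultimately show ?thesis by (simp add: span_singleton_scale)
  qed
  show ?thesis
    unfolding pts_eq[OF sub] pts_eq[OF subspace_H]
  proof (intro equalityI subsetI)
    fix P assume "P \<in> {vec.span {v} |v. v \<noteq> 0 \<and> v \<in> scroll w} \<inter> {vec.span {v} |v. v \<noteq> 0 \<and> v \<in> H}"
    then obtain v v' where vv: "P = vec.span {v}" "v \<noteq> 0" "v \<in> scroll w" "P = vec.span {v'}" "v' \<in> H"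
      by blast
    then have "v \<in> vec.span {v'}" using vec.span_base[of v "{v}"] by simp
    then have "v \<in> H" using vec.span_minimal[of "{v'}" H] vv(5) subspace_H by auto
    then show "P \<in> {vec.span {?u}}" using v vv by simp
  qed (use u in blast)
qed

subsection \<open>The coefficient vectors of the curve\<close>

text \<open>The coefficient of \<open>t ^ i\<close> in the sum of the
  \<open>E j (poly (g j) t *s ver t)\<close>: since \<open>pCons 0\<close> multiplies by the
  variable, the entries belong to the products of \<open>g j\<close> with 1, t and t^2.\<close>

definition curve_coeff :: "(nat \<Rightarrow> 'k poly) \<Rightarrow> nat \<Rightarrow> 'k ^ 9" where
  "curve_coeff g i = (\<Sum>j<3. E j (vector [coeff (g j) i, coeff (pCons 0 (g j)) i, coeff (pCons 0 (pCons 0 (g j))) i]))"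

definition curve :: "(nat \<Rightarrow> 'k poly) \<Rightarrow> nat \<Rightarrow> 'k set \<Rightarrow> ('k ^ 9) set set" where
  "curve g r U = {vec.span {\<Sum>i\<le>r. t ^ i *s curve_coeff g i} | t. t \<in> U} \<union> {vec.span {curve_coeff g r}}"

lemma curve_at:
  assumes "\<And>j. degree (g j) + 2 = r"
  shows "(\<Sum>i\<le>r. t ^ i *s curve_coeff g i) = (\<Sum>j<3. E j (poly (g j) t *s ver t))"
proof -
  have deg: "degree (g j) \<le> r" "degree (pCons 0 (g j)) \<le> r" "degree (pCons 0 (pCons 0 (g j))) \<le> r" for j
    using assms[of j] by (auto simp: degree_pCons_eq_if)
  have "(\<Sum>i\<le>r. t ^ i *s curve_coeff g i) =
      (\<Sum>j<3. E j (\<Sum>i\<le>r. t ^ i *s vector [coeff (g j) i, coeff (pCons 0 (g j)) i, coeff (pCons 0 (pCons 0 (g j))) i]))"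
    unfolding curve_coeff_def by (simp add: vec.scale_sum_right E_scale flip: E_sum) (rule sum.swap)
  also have "\<dots> = (\<Sum>j<3. E j (poly (g j) t *s ver t))"
  proof (rule sum.cong)
    fix j
    have "(\<Sum>i\<le>r. t ^ i *s vector [coeff (g j) i, coeff (pCons 0 (g j)) i, coeff (pCons 0 (pCons 0 (g j))) i]) =
      (vector [poly (g j) t, poly (pCons 0 (g j)) t, poly (pCons 0 (pCons 0 (g j))) t] :: 'k ^ 3)"
      by (simp add: vec3_eq_iff poly_eq_sum_atMost[OF deg(1)] poly_eq_sum_atMost[OF deg(2)]
          poly_eq_sum_atMost[OF deg(3)] mult.commute del: poly_pCons)
    also have "\<dots> = poly (g j) t *s ver t" by (simp add: vec3_eq_iff ver_def power2_eq_square)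
    finally show "E j (\<Sum>i\<le>r. t ^ i *s vector [coeff (g j) i, coeff (pCons 0 (g j)) i, coeff (pCons 0 (pCons 0 (g j))) i]) =
      E j (poly (g j) t *s ver t)" by simp
  qed simp
  finally show ?thesis .
qed

lemma curve_at_inf:
  assumes "\<And>j. degree (g j) + 2 = r"
  shows "curve_coeff g r = (\<Sum>j<3. E j (lead_coeff (g j) *s ver_inf))"
  unfolding curve_coeff_def
proof (rule sum.cong)
  fix j
  have r: "r = Suc (Suc (degree (g j)))" using assms[of j] by simp
  have "vector [coeff (g j) r, coeff (pCons 0 (g j)) r, coeff (pCons 0 (pCons 0 (g j))) r] =
      lead_coeff (g j) *s ver_inf"
    by (simp add: vec3_eq_iff ver_inf_def r coeff_eq_0)
  then show "E j (vector [coeff (g j) r, coeff (pCons 0 (g j)) r, coeff (pCons 0 (pCons 0 (g j))) r]) =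
      E j (lead_coeff (g j) *s ver_inf)" by simp
qed simp

text \<open>The Frobenius map carries the summand of index \<open>j\<close> to that of index
  \<open>j + 1\<close>, so it permutes the three summands and fixes their sum.\<close>

lemma curve_coeff_F:
  assumes "\<And>j. g (Suc j) = cpoly (g j)" "g 3 = g 0"
  shows "curve_coeff g i \<in> vecs_over F"
proof -
  let ?v = "\<lambda>j. vector [coeff (g j) i, coeff (pCons 0 (g j)) i, coeff (pCons 0 (pCons 0 (g j))) i] :: 'k ^ 3"
  have c: "coeff (pCons 0 p) i ^ q = coeff (pCons 0 (cpoly p)) i" for p
    using coeff_cpoly[of "pCons 0 p" i] q_pos by (simp add: power_0_left)
  have v: "frob q (?v j) = ?v (Suc j)" for j
    using q_pos by (simp add: vec3_eq_iff frob_def assms(1) coeff_cpoly c power_0_left)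
  have frob_add: "frob q (x + y) = frob q x + frob q y" for x y :: "'k ^ 9"
    by (simp add: frob_def vec_eq_iff power_q_add)
  have "frob q (curve_coeff g i) = E 1 (?v 1) + E 2 (?v 2) + E 3 (?v 3)"
    unfolding curve_coeff_def
    by (simp add: numeral_3_eq_3 numeral_2_eq_2 frob_add E_frob v)
  also have "\<dots> = curve_coeff g i"
    unfolding curve_coeff_def assms(2) E_add3[of 0, unfolded add_0_left] by (simp add: numeral_3_eq_3 numeral_2_eq_2)
  finally have "frob q (curve_coeff g i) = curve_coeff g i" .
  then show ?thesis by (simp add: vecs_over_def frob_def vec_eq_iff F_iff)
qed

text \<open>
  A linear relation between the coefficient vectors is a linear functional on the polynomials of
  degree at most \<open>r\<close> that vanishes on all multiples \<open>h * g j\<close> with \<open>degree h \<le> 2\<close>.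
\<close>

lemma curve_coeff_independent:
  assumes span: "\<And>p. degree p \<le> r \<Longrightarrow>
      \<exists>h0 h1 h2. degree h0 \<le> 2 \<and> degree h1 \<le> 2 \<and> degree h2 \<le> 2 \<and> p = h0 * g 0 + h1 * g 1 + h2 * g 2"
    and rel: "(\<Sum>i\<le>r. c i *s curve_coeff g i) = 0" and "i \<le> r"
  shows "c i = 0"
proof -
  define \<Lambda> where "\<Lambda> p = (\<Sum>i\<le>r. c i * coeff p i)" for p
  let ?v = "\<lambda>j i. vector [coeff (g j) i, coeff (pCons 0 (g j)) i, coeff (pCons 0 (pCons 0 (g j))) i] :: 'k ^ 3"
  have \<Lambda>_add: "\<Lambda> (p + p') = \<Lambda> p + \<Lambda> p'" and \<Lambda>_smult: "\<Lambda> (smult a p) = a * \<Lambda> p" for p p' a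
    by (simp_all add: \<Lambda>_def sum.distrib sum_distrib_left algebra_simps)
  have "(\<Sum>i\<le>r. c i *s curve_coeff g i) = (\<Sum>j<3. E j (\<Sum>i\<le>r. c i *s ?v j i))"
    unfolding curve_coeff_def by (simp add: vec.scale_sum_right E_scale flip: E_sum) (rule sum.swap)
  also have "\<dots> = E 0 (\<Sum>i\<le>r. c i *s ?v 0 i) + E 1 (\<Sum>i\<le>r. c i *s ?v 1 i) + E 2 (\<Sum>i\<le>r. c i *s ?v 2 i)"
    by (simp add: numeral_3_eq_3 numeral_2_eq_2)
  finally have "E 0 (\<Sum>i\<le>r. c i *s ?v 0 i) + E 1 (\<Sum>i\<le>r. c i *s ?v 1 i) + E 2 (\<Sum>i\<le>r. c i *s ?v 2 i) = 0"
    unfolding rel by (rule sym)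
  note v0 = E_indep[OF this]
  have v0: "(\<Sum>i\<le>r. c i *s ?v j i) = 0" if "j = 0 \<or> j = 1 \<or> j = 2" for j
    using that v0 by (elim disjE) (simp_all only:)
  have \<Lambda>0: "\<Lambda> (h * g j) = 0" if j: "j = 0 \<or> j = 1 \<or> j = 2" and dh: "degree h \<le> 2" for j h
  proof -
    obtain x y z where h: "h = [:x, y, z:]" using dh by (rule degree_le_2E)
    have "\<Lambda> (g j) = 0" "\<Lambda> (pCons 0 (g j)) = 0" "\<Lambda> (pCons 0 (pCons 0 (g j))) = 0"
      using v0[OF j] by (simp_all add: vec3_eq_iff \<Lambda>_def)
    moreover have "h * g j = smult x (g j) + (smult y (pCons 0 (g j)) + smult z (pCons 0 (pCons 0 (g j))))"
      by (simp add: h)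
    ultimately show ?thesis by (simp add: \<Lambda>_add \<Lambda>_smult del: smult_pCons)
  qed
  have "degree (monom (1 :: 'k) i) \<le> r" using assms(3) degree_monom_le le_trans by blast
  then obtain h0 h1 h2 where "degree h0 \<le> 2" "degree h1 \<le> 2" "degree h2 \<le> 2"
    "monom 1 i = h0 * g 0 + h1 * g 1 + h2 * g 2"
    using span by blast
  then have "\<Lambda> (monom 1 i) = 0" by (simp add: \<Lambda>_add \<Lambda>0)
  moreover have "\<Lambda> (monom 1 i) = c i"
    using assms(3) by (simp add: \<Lambda>_def if_distrib[of "\<lambda>x. _ * x"] sum.delta cong: if_cong)
  ultimately show ?thesis by simp
qed

end

text \<open>The common frame of the two cases, with \<open>r = 6\<close> and \<open>r = 3\<close>.
  The \<open>g j\<close> are the multipliers of the overview after cancellation, and \<nu> is the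
  common value; it may have zeros outside \<open>F\<close>. The condition \<open>g_span\<close>
  yields independence of the coefficient vectors.\<close>

locale conic_scroll_curve = conic_scroll q K E \<alpha> H
  for q :: nat and K :: "'k::{field,finite} itself" and E \<alpha> H +
  fixes g :: "nat \<Rightarrow> 'k poly" and r :: nat and \<nu> :: "'k poly"
  assumes g_degree: "degree (g j) + 2 = r"
    and g_cpoly: "g (Suc j) = cpoly (g j)" and g_3: "g 3 = g 0"
    and g_fp: "g j * fp j = \<nu>"
    and \<nu>_F: "t \<in> F \<Longrightarrow> poly \<nu> t \<noteq> 0"
    and g_span: "degree p \<le> r \<Longrightarrow>
      \<exists>h0 h1 h2. degree h0 \<le> 2 \<and> degree h1 \<le> 2 \<and> degree h2 \<le> 2 \<and> p = h0 * g 0 + h1 * g 1 + h2 * g 2"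
begin

lemma pts_scroll_ver: "poly \<nu> t \<noteq> 0 \<Longrightarrow>
    pts (scroll (ver t)) \<inter> pts H = {vec.span {\<Sum>i\<le>r. t ^ i *s curve_coeff g i}}"
  unfolding curve_at[OF g_degree]
  by (rule pts_scroll_H) (simp_all add: lin_form_ver g_fp flip: poly_mult)

text \<open>At the parameter infinity leading coefficients replace values, and that of \<nu> is the
  common value of the forms.\<close>

lemma pts_scroll_ver_inf: "pts (scroll ver_inf) \<inter> pts H = {vec.span {curve_coeff g r}}"
  unfolding curve_at_inf[OF g_degree]
proof (rule pts_scroll_H)
  have "lead_coeff (g j) * lin_form \<alpha> j ver_inf = lead_coeff (g j * fp j)" for j
    by (simp add: lin_form_ver_inf lead_coeff_mult degree_fp)
  then show "lead_coeff (g j) * lin_form \<alpha> j ver_inf = lead_coeff \<nu>" for j by (simp add: g_fp)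
  show "lead_coeff \<nu> \<noteq> 0" using \<nu>_F[of 0] by auto
qed simp

lemma curve_eq: "(\<And>t. t \<in> U \<Longrightarrow> poly \<nu> t \<noteq> 0) \<Longrightarrow>
    (\<Union>w\<in>conic_vecs U. pts (scroll w)) \<inter> pts H = curve g r U"
proof -
  assume U: "\<And>t. t \<in> U \<Longrightarrow> poly \<nu> t \<noteq> 0"
  have "(\<Union>w\<in>conic_vecs U. pts (scroll w)) \<inter> pts H =
      (\<Union>t\<in>U. pts (scroll (ver t)) \<inter> pts H) \<union> (pts (scroll ver_inf) \<inter> pts H)"
    unfolding conic_vecs_eq by blast
  also have "\<dots> = (\<Union>t\<in>U. {vec.span {\<Sum>i\<le>r. t ^ i *s curve_coeff g i}}) \<union> {vec.span {curve_coeff g r}}"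
    by (simp only: pts_scroll_ver[OF U] pts_scroll_ver_inf cong: SUP_cong)
  also have "\<dots> = curve g r U" unfolding curve_def by blast
  finally show ?thesis .
qed

lemma curve_nrc:
  "normal_rational_curve F r (curve g r F)" "normal_rational_curve UNIV r (curve g r UNIV)"
proof -
  have F: "curve_coeff g i \<in> vecs_over F" for i
    using g_cpoly g_3 by (rule curve_coeff_F)
  have ind: "inj_on (curve_coeff g) {..r}" "vec.independent (curve_coeff g ` {..r})"
    by (rule independent_family, rule curve_coeff_independent[OF g_span], assumption+)+
  show "normal_rational_curve F r (curve g r F)"
    unfolding normal_rational_curve_def curve_def
    by (intro exI[of _ "curve_coeff g"] conjI allI impI F ind refl)
  show "normal_rational_curve UNIV r (curve g r UNIV)"
    unfolding normal_rational_curve_def curve_def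
    by (intro exI[of _ "curve_coeff g"] conjI allI impI ind refl) (simp add: vecs_over_def)
qed

lemma curve_subset_PG: "curve g r F \<subseteq> PG F"
proof
  fix P assume P: "P \<in> curve g r F"
  have "curve g r F = (\<Union>w\<in>conic_vecs F. pts (scroll w)) \<inter> pts H"
    by (rule curve_eq [symmetric]) (rule \<nu>_F)
  then have "P \<in> pts H" using P by blast
  then obtain v where v: "P = vec.span {v}" "v \<noteq> 0" unfolding pts_def PG_def by blast
  \<comment> \<open>Membership in \<open>PG F\<close> requires a nonzero spanning vector; that
    \<open>P\<close> is not the zero space is known from \<open>pts H\<close>.\<close>
  have nz: "P \<noteq> {0}" using v vec.span_base[of v "{v}"] by blast
  have cF: "curve_coeff g i \<in> vecs_over F" for i
    using g_cpoly g_3 by (rule curve_coeff_F)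
  have sF: "(\<Sum>i\<le>r. t ^ i *s curve_coeff g i) \<in> vecs_over F" if "t \<in> F" for t
    unfolding vecs_over_def
  proof (intro CollectI allI)
    fix l
    have "t ^ i * curve_coeff g i $ l \<in> F" for i
      using that cF[of i] by (simp add: vecs_over_def)
    then show "(\<Sum>i\<le>r. t ^ i *s curve_coeff g i) $ l \<in> F" by (simp add: F_sum)
  qed
  obtain u where u: "P = vec.span {u}" "u \<in> vecs_over F"
    using P cF sF unfolding curve_def by blast
  moreover have "u \<noteq> 0" using u nz by (metis vec.span_insert_0 vec.span_empty)
  ultimately show "P \<in> PG F" unfolding PG_def by blast
qed

lemma scroll_F_nrc:
  "normal_rational_curve F r ((\<Union>w\<in>conic_vecs F. pts (scroll w)) \<inter> PG F \<inter> pts H)"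
proof -
  have "(\<Union>w\<in>conic_vecs F. pts (scroll w)) \<inter> PG F \<inter> pts H = curve g r F"
    using curve_eq[of F, OF \<nu>_F] curve_subset_PG by blast
  then show ?thesis using curve_nrc(1) by simp
qed

end

section \<open>Partial fractions and the dichotomy between coprime polynomials and a common
  root\<close>

lemma poly_residue:
  fixes f g p :: "'a::field poly"
  assumes "comaximal f g" "degree f = 2"
  obtains h where "degree h < 2" "f dvd p - h * g"
proof -
  obtain u v where uv: "u * f + v * g = 1" using assms by (auto simp: comaximal_def)
  \<comment> \<open>Modulo \<open>f\<close> the Bezout coefficient \<open>v\<close> inverts
    \<open>g\<close>, so \<open>h\<close> is the residue of p / g.\<close>
  define h where "h = (p * v) mod f"
  have "f dvd p * v - h" unfolding h_def by (simp add: minus_mod_eq_mult_div)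
  then have "f dvd p * u * f + (p * v - h) * g" by simp
  also have "p * u * f + (p * v - h) * g = p * (u * f + v * g) - h * g"
    by (simp add: algebra_simps)
  finally have "f dvd p - h * g" using uv by simp
  moreover have "f \<noteq> 0" using assms(2) by auto
  then have "degree h < 2"
    unfolding h_def using degree_mod_less[of f "p * v"] assms(2) by auto
  ultimately show ?thesis using that by blast
qed

text \<open>Residues modulo the three factors leave an error divisible by all of them, hence by
  their product of degree 6. The error is thus a constant multiple of the product, and adding that
  multiple of \<open>f0\<close> to \<open>h0\<close> absorbs it; this is why \<open>h0\<close> may
  reach degree 2.\<close>

lemma poly_partial_fractions3:
  fixes f0 f1 f2 p :: "'a::field poly"
  assumes co: "comaximal f0 f1" "comaximal f1 f2" "comaximal f2 f0"
    and deg: "degree f0 = 2" "degree f1 = 2" "degree f2 = 2" and p: "degree p \<le> 6"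
  shows "\<exists>h0 h1 h2. degree h0 \<le> 2 \<and> degree h1 \<le> 2 \<and> degree h2 \<le> 2 \<and>
    p = h0 * (f1 * f2) + h1 * (f2 * f0) + h2 * (f0 * f1)"
proof -
  have nz: "f0 \<noteq> 0" "f1 \<noteq> 0" "f2 \<noteq> 0" using deg by auto
  have co': "comaximal f0 (f1 * f2)" "comaximal f1 (f2 * f0)" "comaximal f2 (f0 * f1)"
    using co by (auto intro!: comaximal_mult_right simp: comaximal_commute)
  obtain h0 where h0: "degree h0 < 2" "f0 dvd p - h0 * (f1 * f2)"
    using co'(1) deg(1) by (rule poly_residue)
  obtain h1 where h1: "degree h1 < 2" "f1 dvd p - h1 * (f2 * f0)"
    using co'(2) deg(2) by (rule poly_residue)
  obtain h2 where h2: "degree h2 < 2" "f2 dvd p - h2 * (f0 * f1)"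
    using co'(3) deg(3) by (rule poly_residue)
  define e where "e = p - h0 * (f1 * f2) - h1 * (f2 * f0) - h2 * (f0 * f1)"
  have "e = (p - h0 * (f1 * f2)) - f0 * (h1 * f2 + h2 * f1)" by (simp add: e_def algebra_simps)
  then have "f0 dvd e" using h0(2) by simp
  moreover have "e = (p - h1 * (f2 * f0)) - f1 * (h0 * f2 + h2 * f0)" by (simp add: e_def algebra_simps)
  then have "f1 dvd e" using h1(2) by simp
  moreover have "e = (p - h2 * (f0 * f1)) - f2 * (h0 * f1 + h1 * f0)" by (simp add: e_def algebra_simps)
  then have "f2 dvd e" using h2(2) by simp
  ultimately have "f0 * (f1 * f2) dvd e"
    using co co' comaximal_dvd_mult by blast
  then obtain k where k: "e = f0 * (f1 * f2) * k" by blast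
  have dm: "degree (h * (f * f')) \<le> 6" if "degree h < 2" "degree f = 2" "degree f' = 2" for h f f' :: "'a poly"
    using degree_mult_le[of h "f * f'"] degree_mult_le[of f f'] that by linarith
  have "degree e \<le> 6"
    unfolding e_def by (intro degree_diff_le p dm h0 h1 h2 deg)
  have "degree k = 0"
  proof (cases "k = 0")
    case False
    then have "degree e = 6 + degree k"
      using nz deg by (simp add: k degree_mult_eq)
    then show ?thesis using \<open>degree e \<le> 6\<close> by simp
  qed simp
  have "p = (h0 + f0 * k) * (f1 * f2) + h1 * (f2 * f0) + h2 * (f0 * f1)"
    using k unfolding e_def by (simp add: algebra_simps)
  moreover have "degree (h0 + f0 * k) \<le> 2"
    using h0(1) degree_mult_le[of f0 k] deg \<open>degree k = 0\<close> by (intro degree_add_le) auto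
  ultimately show ?thesis using h1(1) h2(1) by (intro exI conjI) auto
qed

context conic_scroll
begin

lemma E_minus: "E j (- x) = - E j x"
  using E_scale[of j "- 1" x] by simp

lemma fp_index: "fp (0 + 1) = fp 1" "fp (0 + 2) = fp 2" "fp (1 + 1) = fp 2" "fp (1 + 2) = fp 0"
  "fp (2 + 1) = fp 0" "fp (2 + 2) = fp 1"
  by (simp_all only: index_add fp_add3)

lemma fp_shift_add3: "fp (i + 3) = fp i" "fp (i + 3 + 1) = fp (i + 1)" "fp (i + 3 + 2) = fp (i + 2)"
  using fp_add3[of i] fp_add3[of "i + 1"] fp_add3[of "i + 2"] by (simp_all add: add_ac)

lemma conic_scroll_curve_coprime:
  assumes co: "comaximal (fp 0) (fp 1)"
  shows "conic_scroll_curve q E \<alpha> H (\<lambda>j. fp (j + 1) * fp (j + 2)) 6 (fp 0 * fp 1 * fp 2)"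
proof unfold_locales
  fix j
  show "degree (fp (j + 1) * fp (j + 2)) + 2 = 6" by (simp add: degree_mult_eq degree_fp)
  show "fp (Suc j + 1) * fp (Suc j + 2) = cpoly (fp (j + 1) * fp (j + 2))"
    by (simp add: fp_Suc)
  show "fp (3 + 1) * fp (3 + 2) = fp (0 + 1) * fp (0 + 2)"
    using fp_shift_add3[of 0] by simp
  show "fp (j + 1) * fp (j + 2) * fp j = fp 0 * fp 1 * fp 2"
  proof (induction j rule: nat_mod_3_induct)
    case (step n) then show ?case by (simp only: fp_shift_add3)
  qed (simp_all only: fp_index mult_ac)
next
  fix t assume "t \<in> F"
  then show "poly (fp 0 * fp 1 * fp 2) t \<noteq> 0" by (simp add: poly_fp_nonzero)
next
  fix p :: "'k poly" assume p: "degree p \<le> 6"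
  have f: "cpoly (fp 0) = fp 1" "cpoly (fp 1) = fp 2" "cpoly (fp 2) = fp 0"
    using fp_Suc[of 0] fp_Suc[of 1] fp_Suc[of 2] fp_add3[of 0]
    by (simp_all add: numeral_2_eq_2 numeral_3_eq_3)
  \<comment> \<open>Frobenius carries the Bezout relation for one pair to the next pair.\<close>
  have co': "comaximal (fp 1) (fp 2)" "comaximal (fp 2) (fp 0)"
    using comaximal_cpoly[OF co] comaximal_cpoly[OF comaximal_cpoly[OF co]] unfolding f by blast+
  show "\<exists>h0 h1 h2. degree h0 \<le> 2 \<and> degree h1 \<le> 2 \<and> degree h2 \<le> 2 \<and>
      p = h0 * (fp (0 + 1) * fp (0 + 2)) + h1 * (fp (1 + 1) * fp (1 + 2)) + h2 * (fp (2 + 1) * fp (2 + 2))"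
    unfolding fp_index by (rule poly_partial_fractions3[OF co co' degree_fp(1) degree_fp(1) degree_fp(1) p])
qed

text \<open>A common factor of degree 2 would make \<open>fp 1\<close> a multiple of
  \<open>fp 0\<close>, against the independence of the coefficients over \<open>F\<close>. So it is
  linear and has a root in the field, and conjugating back gives the second root of
  \<open>fp 0\<close>.\<close>

lemma fp_common_root:
  assumes "\<not> comaximal (fp 0) (fp 1)"
  obtains \<rho> where "poly (fp 0) \<rho> = 0" "poly (fp 0) (\<rho> ^ q) = 0" "\<rho> ^ q \<noteq> \<rho>"
proof -
  obtain d where d: "d dvd fp 0" "d dvd fp 1" "degree d \<noteq> 0"
    using assms poly_comaximalI[OF degree_fp(2)] by blast
  obtain k0 where k0: "fp 0 = d * k0" using d by blast
  obtain k1 where k1: "fp 1 = d * k1" using d by blast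
  have nz: "d \<noteq> 0" "k0 \<noteq> 0" "k1 \<noteq> 0" using degree_fp(2)[of 0] degree_fp(2)[of 1] k0 k1 by auto
  then have deg: "degree d + degree k0 = 2" "degree d + degree k1 = 2"
    using degree_fp(1)[of 0] degree_fp(1)[of 1] k0 k1 by (auto simp: degree_mult_eq)
  have "degree d = 1"
  proof (rule ccontr)
    assume "degree d \<noteq> 1"
    then have "degree k0 = 0" "degree k1 = 0" using deg d(3) by auto
    then obtain c0 c1 where c: "k0 = [:c0:]" "k1 = [:c1:]" by (meson degree_eq_zeroE)
    have fp01: "fp 0 = smult c0 d" "fp 1 = smult c1 d" unfolding k0 k1 c by simp_all
    have "c0 \<noteq> 0" using nz(2) c(1) by simp
    then have "fp 1 = smult (c1 / c0) (fp 0)" unfolding fp01 by simp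
    then have e: "(\<alpha> $ i) ^ q = (c1 / c0) * \<alpha> $ i" if "i = 1 \<or> i = 3" for i
      using that by (auto simp: fp_def)
    \<comment> \<open>Raising to the power q multiplies both outer coefficients by the same factor,
      so their ratio lies in \<open>F\<close> and gives a forbidden linear relation.\<close>
    define s where "s = \<alpha> $ 1 / \<alpha> $ 3"
    have "s \<in> F"
      using e[of 1] e[of 3] \<alpha>3_nonzero nz c by (simp add: s_def F_iff power_divide)
    then have v: "(vector [1, 0, - s] :: 'k ^ 3) \<in> vecs_over F" by (simp add: vecs_over_def forall_3)
    have "\<alpha> $ 1 = s * \<alpha> $ 3" using \<alpha>3_nonzero by (simp add: s_def)
    then have "lin_form \<alpha> 0 (vector [1, 0, - s]) = 0" by (simp add: lin_form_def sum_3)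
    then have "vector [1, 0, - s] = (0 :: 'k ^ 3)" by (rule \<alpha>_indep[OF v])
    then show False by (simp add: vec3_eq_iff)
  qed
  then obtain a b where ab: "d = [:a, b:]" "b \<noteq> 0"
    by (cases d) (auto simp: degree_pCons_eq_if split: if_splits elim!: degree_eq_zeroE)
  define r where "r = - a / b"
  have "poly d r = 0" using ab by (simp add: r_def)
  then have r: "poly (fp 0) r = 0" "poly (fp 1) r = 0" unfolding k0 k1 by simp_all
  \<comment> \<open>The power q^2 inverts the power q. As \<open>fp 1\<close> is the conjugate of
    \<open>fp 0\<close>, the root \<open>r\<close> of \<open>fp 1\<close> is the conjugate of a root
    of \<open>fp 0\<close>.\<close>
  define \<rho> where "\<rho> = r ^ q\<^sup>2"
  have \<rho>: "\<rho> ^ q = r" by (simp add: \<rho>_def power_q2_q)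
  have "poly (fp 0) \<rho> ^ q = poly (fp 1) (\<rho> ^ q)" using fp_Suc[of 0] poly_cpoly[of "fp 0" \<rho>] by simp
  then have "poly (fp 0) \<rho> = 0" using r \<rho> q_pos by simp
  moreover have "\<rho> ^ q \<noteq> \<rho>"
    using poly_fp_nonzero[of \<rho> 0] \<open>poly (fp 0) \<rho> = 0\<close> by (auto simp: F_iff)
  ultimately show ?thesis using that[of \<rho>] r \<rho> by simp
qed

text \<open>The transversal lines of the spread at infinity; index 0 belongs to the line at infinity
  itself.\<close>

definition transversal :: "nat \<Rightarrow> ('k ^ 9) set" where
  "transversal j = E j ` {x. lin_form \<alpha> j x = 0}"

lemma frob_transversal: "frob q ` transversal j = transversal (Suc j)"
proof (intro equalityI subsetI)
  fix u assume "u \<in> transversal (Suc j)"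
  then obtain x where x: "u = E (Suc j) x" "lin_form \<alpha> (Suc j) x = 0" unfolding transversal_def by blast
  define y where "y = frob (q\<^sup>2) x"
  have y: "frob q y = x" by (simp add: y_def frob_def vec_eq_iff power_q2_q)
  then have "lin_form \<alpha> j y = 0" using x lin_form_frob[of \<alpha> j y] q_pos by simp
  moreover have "u = frob q (E j y)" by (simp add: E_frob x y)
  ultimately show "u \<in> frob q ` transversal j" unfolding transversal_def by blast
qed (use q_pos in \<open>auto simp: transversal_def E_frob lin_form_frob power_0_left\<close>)

lemma frob_twice: "frob q (frob q x) = frob (q\<^sup>2) (x :: 'k ^ 'n)"
  by (simp add: frob_def vec_eq_iff power_q2_q)

end

section \<open>The case of a common root\<close>

locale conic_scroll_split = conic_scroll q K E \<alpha> H
  for q :: nat and K :: "'k::{field,finite} itself" and E \<alpha> H +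
  fixes \<rho> :: 'k
  assumes roots: "poly (fp 0) \<rho> = 0" "poly (fp 0) (\<rho> ^ q) = 0" and \<rho>: "\<rho> ^ q \<noteq> \<rho>"
begin

definition root :: "nat \<Rightarrow> 'k" where "root j = \<rho> ^ (q ^ j)"
definition L :: "nat \<Rightarrow> 'k poly" where "L j = [:- root j, 1:]"
definition lc :: "nat \<Rightarrow> 'k" where "lc j = (\<alpha> $ 3) ^ (q ^ j)"
text \<open>What remains of \<open>fp (j + 1) * fp (j + 2)\<close> after division by
  \<open>L 0 * L 1 * L 2\<close>, given the factorisation \<open>fp_eq\<close>.\<close>

definition g :: "nat \<Rightarrow> 'k poly" where "g j = smult (lc (j + 1) * lc (j + 2)) (L (j + 2))"
definition \<nu> :: "'k poly" where "\<nu> = smult (lc 0 * lc 1 * lc 2) (L 0 * L 1 * L 2)"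

lemma root_Suc: "root (Suc j) = root j ^ q" and lc_Suc: "lc (Suc j) = lc j ^ q"
  by (simp_all add: root_def lc_def power_mult mult.commute[of q])

lemma root_add3: "root (j + 3) = root j" and lc_add3: "lc (j + 3) = lc j"
  by (simp_all add: root_def lc_def power_add power_mult power_q3)

lemmas root_add3_Suc = root_add3[unfolded numeral_3_eq_3 add_Suc_right add_0_right]

lemma L_Suc: "L (Suc j) = cpoly (L j)"
  using power_q_diff[of 0 "root j"] q_pos by (simp add: L_def root_Suc)

lemma L_add3: "L (j + 3) = L j"
  by (simp add: L_def root_add3)

lemma lc_nonzero: "lc j \<noteq> 0"
  using \<alpha>3_nonzero by (simp add: lc_def)

lemma root_neq: "root (Suc j) \<noteq> root j"
proof (induction j)
  case (Suc j)
  then show ?case using root_Suc power_q_inj by metis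
qed (use \<rho> in \<open>simp add: root_def\<close>)

lemma fp_eq: "fp j = smult (lc j) (L j * L (j + 1))"
proof (induction j)
  case 0
  let ?\<sigma> = "\<rho> ^ q"
  have 1: "\<alpha> $ 1 + \<rho> * (\<alpha> $ 2 + \<rho> * \<alpha> $ 3) = 0" and 2: "\<alpha> $ 1 + ?\<sigma> * (\<alpha> $ 2 + ?\<sigma> * \<alpha> $ 3) = 0"
    using roots by (simp_all add: fp_def)
  \<comment> \<open>Vieta's formulas: the difference of the two root equations is divisible by the
    nonzero difference of the roots.\<close>
  have "(?\<sigma> - \<rho>) * (\<alpha> $ 2 + (?\<sigma> + \<rho>) * \<alpha> $ 3) =
      (\<alpha> $ 1 + ?\<sigma> * (\<alpha> $ 2 + ?\<sigma> * \<alpha> $ 3)) - (\<alpha> $ 1 + \<rho> * (\<alpha> $ 2 + \<rho> * \<alpha> $ 3))"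
    by (simp add: algebra_simps)
  then have "\<alpha> $ 2 + (?\<sigma> + \<rho>) * \<alpha> $ 3 = 0" using 1 2 \<rho> by simp
  then have a2: "\<alpha> $ 2 = - ((?\<sigma> + \<rho>) * \<alpha> $ 3)" by (simp add: eq_neg_iff_add_eq_0)
  have "\<alpha> $ 1 = - (\<rho> * (\<alpha> $ 2 + \<rho> * \<alpha> $ 3))" using 1 by (simp add: eq_neg_iff_add_eq_0)
  then have "\<alpha> $ 1 = \<alpha> $ 3 * \<rho> * ?\<sigma>" by (simp add: a2 algebra_simps)
  with a2 show ?case by (simp add: fp_def L_def root_def lc_def algebra_simps)
next
  case (Suc j)
  then show ?case by (simp add: fp_Suc lc_Suc L_Suc)
qed

lemma L_index: "L (0 + 1) = L 1" "L (0 + 2) = L 2" "L (1 + 1) = L 2" "L (1 + 2) = L 0"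
  "L (2 + 1) = L 0" "L (2 + 2) = L 1"
  by (simp_all only: index_add L_add3)

lemma lc_index: "lc (0 + 1) = lc 1" "lc (0 + 2) = lc 2" "lc (1 + 1) = lc 2" "lc (1 + 2) = lc 0"
  "lc (2 + 1) = lc 0" "lc (2 + 2) = lc 1"
  by (simp_all only: index_add lc_add3)

lemma L_shift_add3: "L (i + 3) = L i" "L (i + 3 + 1) = L (i + 1)" "L (i + 3 + 2) = L (i + 2)"
  using L_add3[of i] L_add3[of "i + 1"] L_add3[of "i + 2"] by (simp_all add: add_ac)

lemma lc_shift_add3: "lc (i + 3) = lc i" "lc (i + 3 + 1) = lc (i + 1)" "lc (i + 3 + 2) = lc (i + 2)"
  using lc_add3[of i] lc_add3[of "i + 1"] lc_add3[of "i + 2"] by (simp_all add: add_ac)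

lemma g_mult_fp: "g j * fp j = \<nu>"
proof (induction j rule: nat_mod_3_induct)
  case (step n)
  then show ?case unfolding g_def fp_eq by (simp only: L_shift_add3 lc_shift_add3)
qed (simp_all only: g_def fp_eq \<nu>_def L_index lc_index mult_smult_left mult_smult_right smult_smult mult_ac)

text \<open>Two of the three linear polynomials suffice: division by \<open>L 1\<close> leaves a
  constant, and constants are multiples of \<open>L 0 - L 1\<close>.\<close>

lemma linear_decomposition:
  assumes "degree p \<le> 3"
  shows "\<exists>h0 h1 h2. degree h0 \<le> 2 \<and> degree h1 \<le> 2 \<and> degree h2 \<le> 2 \<and> p = h0 * g 0 + h1 * g 1 + h2 * g 2"
proof -
  define s where "s = p div L 1"
  have L1: "L 1 \<noteq> 0" "degree (L 1) = 1" by (simp_all add: L_def)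
  have "degree (p mod L 1) = 0" using degree_mod_less[OF L1(1), of p] L1 by auto
  then obtain c where c: "p mod L 1 = [:c:]" by (rule degree_eq_zeroE)
  have p: "p = s * L 1 + [:c:]" unfolding s_def c[symmetric] by simp
  have ds: "degree s \<le> 2"
  proof (cases "s = 0")
    case False
    then have "degree s + 1 = degree (s * L 1)" using degree_mult_eq[OF False L1(1)] L1(2) by simp
    also have "s * L 1 = p - [:c:]" using p by simp
    also have "degree \<dots> \<le> 3" by (rule degree_diff_le[OF assms]) simp
    finally show ?thesis by simp
  qed simp
  define d where "d = root 1 - root 0"
  have d: "d \<noteq> 0" using root_neq[of 0] by (simp add: d_def)
  have "L 0 - L 1 = [:d:]" by (simp add: L_def d_def)
  then have "[:c:] = smult (c / d) (L 0 - L 1)" using d by simp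
  then have p2: "p = [:c / d:] * L 0 + (s - [:c / d:]) * L 1"
    using p by (simp add: algebra_simps smult_diff_right)
  let ?k1 = "lc 2 * lc 0" and ?k2 = "lc 0 * lc 1"
  have g: "g 1 = smult ?k1 (L 0)" "g 2 = smult ?k2 (L 1)"
    unfolding g_def L_index lc_index by simp_all
  have "p = 0 * g 0 + smult (1 / ?k1) [:c / d:] * g 1 + smult (1 / ?k2) (s - [:c / d:]) * g 2"
    unfolding g using lc_nonzero by (subst p2) simp
  moreover have "degree (smult (1 / ?k2) (s - [:c / d:])) \<le> 2"
    using ds by (intro order_trans[OF degree_smult_le] degree_diff_le) auto
  moreover have "degree (smult (1 / ?k1) [:c / d:]) \<le> 2" by simp
  ultimately show ?thesis by (metis degree_0 le0)
qed

sublocale conic_scroll_curve q K E \<alpha> H g 3 \<nu>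
proof unfold_locales
  fix j
  show "degree (g j) + 2 = 3" using lc_nonzero by (simp add: g_def L_def)
  show "g (Suc j) = cpoly (g j)"
    by (simp add: g_def lc_Suc L_Suc power_mult_distrib)
  show "g 3 = g 0" using L_shift_add3[of 0] lc_shift_add3[of 0] by (simp add: g_def)
  show "g j * fp j = \<nu>" by (rule g_mult_fp)
next
  fix t assume t: "t \<in> F"
  have "g 0 * fp 0 = \<nu>" by (rule g_mult_fp)
  moreover have "poly (L 2) t \<noteq> 0"
    using poly_fp_nonzero[OF t, of 2] unfolding fp_eq by auto
  ultimately show "poly \<nu> t \<noteq> 0"
    using poly_fp_nonzero[OF t, of 0] lc_nonzero by (auto simp: g_def numeral_2_eq_2 simp flip: \<open>g 0 * fp 0 = \<nu>\<close>)
qed (rule linear_decomposition)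

lemma poly_L: "poly (L j) t = t - root j"
  by (simp add: L_def)

lemma poly_\<nu>_eq_0: "poly \<nu> t = 0 \<longleftrightarrow> t = root 0 \<or> t = root 1 \<or> t = root 2"
  using lc_nonzero by (auto simp: \<nu>_def poly_L)

text \<open>\<open>L i\<close> divides \<open>fp i\<close> and \<open>fp (i + 2)\<close> but not
  \<open>fp (i + 1)\<close>. So at the parameter \<open>root i\<close> exactly the forms of index
  \<open>i\<close> and \<open>i + 2\<close> vanish, and these two indices span the line.\<close>

definition tline :: "nat \<Rightarrow> ('k ^ 9) set" where
  "tline i = vec.span {E i (ver (root i)), E (i + 2) (ver (root i))}"

lemma lin_form_ver_root:
  "lin_form \<alpha> i (ver (root i)) = 0" "lin_form \<alpha> (i + 2) (ver (root i)) = 0"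
  "lin_form \<alpha> (i + 1) (ver (root i)) \<noteq> 0"
proof -
  have "root (i + 2 + 1) = root i" using root_add3[of i] by (simp add: root_add3_Suc)
  then show "lin_form \<alpha> i (ver (root i)) = 0" "lin_form \<alpha> (i + 2) (ver (root i)) = 0"
    by (simp_all add: lin_form_ver fp_eq poly_L)
  have "root i \<noteq> root (i + 1)" using root_neq[of i] by simp
  moreover have "root i \<noteq> root (i + 1 + 1)"
    using root_neq[of "i + 1 + 1"] by (simp add: root_add3_Suc)
  ultimately show "lin_form \<alpha> (i + 1) (ver (root i)) \<noteq> 0"
    using lc_nonzero by (simp add: lin_form_ver fp_eq poly_L)
qed

lemma tline_eq: "tline i = {E i (a *s ver (root i)) + E (i + 2) (c *s ver (root i)) | a c. True}"
  unfolding tline_def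
  by (auto simp: vec.span_insert vec.span_singleton E_scale algebra_simps)

lemma subspace_tline: "vec.subspace (tline i)"
  unfolding tline_def by (rule vec.subspace_span)

text \<open>The common value of the forms is forced to be 0, which kills the coefficient of index
  \<open>i + 1\<close> and leaves the other two free.\<close>

lemma scroll_root_H: "scroll (ver (root i)) \<inter> H = tline i"
proof (intro equalityI subsetI)
  let ?w = "ver (root i)"
  fix u assume u: "u \<in> scroll ?w \<inter> H"
  then obtain a b c where abc: "u = E i (a *s ?w) + E (i + 1) (b *s ?w) + E (i + 2) (c *s ?w)"
    unfolding scroll_eq[of ?w i] by blast
  then have "a * lin_form \<alpha> i ?w = b * lin_form \<alpha> (i + 1) ?w"
    using u H_iff_shift[of i "a *s ?w" "b *s ?w" "c *s ?w"] by (simp add: lin_form_linear)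
  then have "b = 0" using lin_form_ver_root[of i] by simp
  then have "u = E i (a *s ?w) + E (i + 2) (c *s ?w)" unfolding abc by (simp add: E_0)
  then show "u \<in> tline i" unfolding tline_eq by blast
next
  let ?w = "ver (root i)"
  fix u assume "u \<in> tline i"
  then obtain a c where u: "u = E i (a *s ?w) + E (i + 2) (c *s ?w)" unfolding tline_eq by blast
  then have u': "u = E i (a *s ?w) + E (i + 1) (0 *s ?w) + E (i + 2) (c *s ?w)" by (simp add: E_0)
  have "u \<in> scroll ?w" unfolding u' scroll_eq[of ?w i] by blast
  moreover have "u \<in> H"
    unfolding u' H_iff_shift by (simp only: lin_form_linear lin_form_ver_root mult_zero_left mult_zero_right)
  ultimately show "u \<in> scroll ?w \<inter> H" by blast
qed

lemma pts_Int: "pts (A \<inter> B) = pts A \<inter> pts B"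
  by (auto simp: pts_def)

text \<open>At a root of \<nu> the curve point is not the whole intersection with the plane, so it
  needs its own argument: \<open>g (i + 1)\<close> vanishes at \<open>root i\<close>, whereas
  \<open>g i\<close> does not.\<close>

lemma curve_point_tline: "vec.span {\<Sum>l\<le>3. root i ^ l *s curve_coeff g l} \<in> pts (tline i)"
proof -
  let ?t = "root i"
  have shift: "(\<Sum>j<3. E j (poly (g j) t *s ver t)) = E i (poly (g i) t *s ver t) +
      E (i + 1) (poly (g (i + 1)) t *s ver t) + E (i + 2) (poly (g (i + 2)) t *s ver t)" for t
  proof (induction i rule: nat_mod_3_induct)
    have g_index: "g (0 + 1) = g 1" "g (0 + 2) = g 2" "g (1 + 1) = g 2" "g (1 + 2) = g 0"
      "g (2 + 1) = g 0" "g (2 + 2) = g 1"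
      unfolding g_def by (simp_all only: index_add L_shift_add3 lc_shift_add3 L_add3 lc_add3)
    have s: "(\<Sum>j<3. E j (poly (g j) t *s ver t)) = E 0 (poly (g 0) t *s ver t) +
      E 1 (poly (g 1) t *s ver t) + E 2 (poly (g 2) t *s ver t)"
      by (simp add: numeral_3_eq_3 numeral_2_eq_2)
    case 0 show ?case unfolding s E_index g_index ..
    case 1 show ?case unfolding s E_index g_index rotate_sum ..
    case 2 show ?case unfolding s E_index g_index rotate_sum ..
  next
    case (step n)
    have g_add3: "g (n + 3) = g n" for n
      unfolding g_def L_shift_add3 lc_shift_add3 ..
    have "g (n + 3) = g n" "g (n + 3 + 1) = g (n + 1)" "g (n + 3 + 2) = g (n + 2)"
      using g_add3[of n] g_add3[of "n + 1"] g_add3[of "n + 2"] by (simp_all add: add_ac)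
    then show ?case using step by (simp only: E_shift_add3)
  qed
  have "poly (g (i + 1)) ?t = 0" by (simp add: g_def poly_L root_add3_Suc)
  then have eq: "(\<Sum>l\<le>3. ?t ^ l *s curve_coeff g l) =
      E i (poly (g i) ?t *s ver ?t) + E (i + 2) (poly (g (i + 2)) ?t *s ver ?t)"
    unfolding curve_at[OF g_degree] shift by (simp add: E_0)
  have "poly (g i) ?t \<noteq> 0"
    using root_neq[of "i + 2"] lc_nonzero by (auto simp: g_def poly_L root_add3_Suc)
  then have "(\<Sum>l\<le>3. ?t ^ l *s curve_coeff g l) \<noteq> 0"
    using E_indep_shift[of i "poly (g i) ?t *s ver ?t" 0 "poly (g (i + 2)) ?t *s ver ?t"]
    unfolding eq by (auto simp: E_0)
  moreover have "(\<Sum>l\<le>3. ?t ^ l *s curve_coeff g l) \<in> tline i"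
    unfolding eq tline_eq by blast
  ultimately show ?thesis unfolding pts_eq[OF subspace_tline] by blast
qed

lemma scroll_star_eq:
  "(\<Union>w\<in>conic_vecs UNIV. pts (scroll w)) \<inter> pts H =
    curve g 3 UNIV \<union> pts (tline 0) \<union> pts (tline 1) \<union> pts (tline 2)" (is "?S = ?R")
proof -
  have t: "pts (scroll (ver (root i))) \<inter> pts H = pts (tline i)" for i
    unfolding scroll_root_H[symmetric] pts_Int ..
  define c where "c t = vec.span {\<Sum>i\<le>3. t ^ i *s curve_coeff g i}" for t
  have c: "curve g 3 UNIV = range c \<union> {vec.span {curve_coeff g 3}}"
    unfolding curve_def c_def by blast
  have n: "pts (scroll (ver t)) \<inter> pts H = {c t}" if "t \<noteq> root 0" "t \<noteq> root 1" "t \<noteq> root 2" for t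
    unfolding c_def using that by (intro pts_scroll_ver) (simp add: poly_\<nu>_eq_0)
  have S: "?S = (\<Union>t. pts (scroll (ver t)) \<inter> pts H) \<union> {vec.span {curve_coeff g 3}}"
    unfolding conic_vecs_eq pts_scroll_ver_inf[symmetric] by blast
  have ct: "c (root i) \<in> pts (tline i)" for i unfolding c_def by (rule curve_point_tline)
  show ?thesis
  proof (intro equalityI subsetI)
    fix P assume "P \<in> ?S"
    then consider t where "P \<in> pts (scroll (ver t)) \<inter> pts H" | "P = vec.span {curve_coeff g 3}"
      unfolding S by blast
    then show "P \<in> ?R"
    proof cases
      case 1
      show ?thesis
      proof (cases "t = root 0 \<or> t = root 1 \<or> t = root 2")
        case True
        then show ?thesis using 1 t by blast
      next
        case False
        then show ?thesis using 1 n[of t] c by blast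
      qed
    qed (use c in blast)
  next
    fix P assume "P \<in> ?R"
    then consider i where "P \<in> pts (tline i)" | t where "P = c t" | "P = vec.span {curve_coeff g 3}"
      using c by blast
    then show "P \<in> ?S"
    proof cases
      case 1 then show ?thesis unfolding S using t by blast
    next
      case (2 t)
      then show ?thesis unfolding S using n[of t] t ct by (cases "t = root 0 \<or> t = root 1 \<or> t = root 2") blast+
    next
      case 3 then show ?thesis unfolding S by blast
    qed
  qed
qed

lemma tline_add3: "tline (i + 3) = tline i"
  unfolding tline_def E_shift_add3 root_add3 ..

text \<open>\<open>tline i\<close> has no component of index \<open>i + 1\<close>, while
  \<open>tline (i + 1)\<close> does. By period 3 consecutive indices cover all pairs of
  lines.\<close>

lemma tline_neq: "tline (i + 1) \<noteq> tline i"
proof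
  assume *: "tline (i + 1) = tline i"
  have "E (i + 1) (ver (root (i + 1))) \<in> tline (i + 1)" unfolding tline_def by (simp add: vec.span_base)
  then obtain a c where "E (i + 1) (ver (root (i + 1))) = E i (a *s ver (root i)) + E (i + 2) (c *s ver (root i))"
    unfolding * unfolding tline_eq by blast
  then have "E i (a *s ver (root i)) + E (i + 1) (- 1 *s ver (root (i + 1))) + E (i + 2) (c *s ver (root i)) = 0"
    by (simp add: E_scale E_minus)
  then show False using E_indep_shift[of i] by fastforce
qed

text \<open>The two spanning vectors lie on the transversals of index \<open>i\<close> and
  \<open>i + 2\<close>, because the forms of these indices vanish at
  \<open>ver (root i)\<close>.\<close>

lemma tline_T_line: "i < 3 \<Longrightarrow> T_line q (transversal 0) (tline i)"
proof -
  assume i: "i < 3"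
  let ?w = "ver (root i)"
  have f1: "frob q ` transversal 0 = transversal 1" using frob_transversal[of 0] by simp
  have "frob (q\<^sup>2) ` transversal 0 = frob q ` frob q ` transversal 0"
    unfolding image_image frob_twice ..
  also have "\<dots> = transversal 2" unfolding f1 using frob_transversal[of 1] by (simp add: numeral_2_eq_2)
  finally have f2: "frob (q\<^sup>2) ` transversal 0 = transversal 2" .
  have tr3: "transversal (j + 3) = transversal j" for j
    unfolding transversal_def using E_add3 lin_form_add3 by simp
  have mem: "transversal j \<in> {transversal 0, frob q ` transversal 0, frob (q\<^sup>2) ` transversal 0}" for j
    unfolding f1 f2 by (induction j rule: nat_mod_3_induct) (simp_all add: tr3)
  have w: "E i ?w \<in> transversal i" "E (i + 2) ?w \<in> transversal (i + 2)"
    unfolding transversal_def using lin_form_ver_root[of i] by auto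
  have nz: "E j x = 0 \<Longrightarrow> x = 0" for j x using E_indep_shift[of j x 0 0] by (simp add: E_0)
  have Enz: "E i ?w \<noteq> 0" "E (i + 2) ?w \<noteq> 0" using nz ver_nonzero by blast+
  have span: "conj_span q (transversal 0) = vec.span (transversal 0 \<union> transversal 1 \<union> transversal 2)"
    unfolding conj_span_def f1 f2 ..
  have tr_span: "transversal j \<subseteq> conj_span q (transversal 0)" for j
    using mem[of j] unfolding conj_span_def by (auto intro: vec.span_base)
  have sub: "tline i \<subseteq> conj_span q (transversal 0)"
    unfolding tline_def using w tr_span
    by (intro vec.span_minimal) (auto simp: conj_span_def vec.subspace_span)
  have "E i ?w \<noteq> E (i + 2) ?w"
  proof
    assume "E i ?w = E (i + 2) ?w"
    then have "E i ?w + E (i + 1) 0 + E (i + 2) (- 1 *s ?w) = 0" by (simp add: E_0 E_scale E_minus)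
    then show False using E_indep_shift[of i ?w 0 "- 1 *s ?w"] by simp
  qed
  moreover have ind: "vec.independent {E i ?w, E (i + 2) ?w}"
  proof (rule vec.independent_insertI)
    show "E i ?w \<notin> vec.span {E (i + 2) ?w}"
    proof
      assume "E i ?w \<in> vec.span {E (i + 2) ?w}"
      then obtain k where "E i ?w = k *s E (i + 2) ?w" by (auto simp: vec.span_singleton)
      then have "E i ?w + E (i + 1) 0 + E (i + 2) (- k *s ?w) = 0" by (simp add: E_0 E_scale E_minus)
      then show False using E_indep_shift[of i ?w 0 "- k *s ?w"] by simp
    qed
  qed (use Enz in simp)
  ultimately have dim: "vec.dim (tline i) = 2"
    unfolding tline_def vec.dim_span_eq_card_independent[OF ind] by simp
  have pt: "vec.span {u} \<in> pts W" if "u \<in> W" "u \<noteq> 0" "vec.subspace W" for u :: "'k ^ 9" and W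
    unfolding pts_eq[OF that(3)] using that by blast
  have sub_tr: "vec.subspace (transversal j)" for j
    unfolding transversal_def
    by (rule vec.linear_subspace_image[OF E_linear]) (simp add: vec.subspace_def lin_form_linear)
  have neq: "transversal i \<noteq> transversal (i + 2)"
  proof
    assume "transversal i = transversal (i + 2)"
    then obtain z where "E i ?w = E (i + 2) z" using w unfolding transversal_def by blast
    then have "E i ?w + E (i + 1) 0 + E (i + 2) (- 1 *s z) = 0" by (simp add: E_0 E_scale E_minus)
    then show False using E_indep_shift[of i ?w 0 "- 1 *s z"] by simp
  qed
  have "E i ?w \<in> tline i" "E (i + 2) ?w \<in> tline i" unfolding tline_def by (simp_all add: vec.span_base)
  then have "pts (tline i) \<inter> pts (transversal i) \<noteq> {}" "pts (tline i) \<inter> pts (transversal (i + 2)) \<noteq> {}"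
    using pt[OF _ _ subspace_tline] pt[OF _ _ sub_tr] w Enz by blast+
  moreover have "{transversal i, transversal (i + 2)} \<subseteq>
      {transversal 0, frob q ` transversal 0, frob (q\<^sup>2) ` transversal 0}"
    using mem by blast
  moreover have "pg_subspace 1 (tline i)"
    unfolding pg_subspace_def using dim subspace_tline by simp
  ultimately show ?thesis
    unfolding T_line_def using sub neq by blast
qed

end

section \<open>The Bose representation\<close>

text \<open>Reduces membership in a subspace to scalar equations, the coordinates of
  \<open>h\<close>.\<close>

lemma separating_linear_map:
  fixes V :: "('k::field ^ 'n) set"
  assumes "vec.subspace V" "u \<notin> V"
  obtains h :: "'k ^ 'n \<Rightarrow> 'k ^ 'n" where "Vector_Spaces.linear (*s) (*s) h" "\<And>v. v \<in> V \<Longrightarrow> h v = 0" "h u \<noteq> 0"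
proof -
  obtain B where B: "B \<subseteq> V" "vec.independent B" "V \<subseteq> vec.span B"
    using vec.basis_exists[of V] by metis
  have VB: "vec.span B = V" using vec.span_minimal[OF B(1) assms(1)] B(3) by (rule antisym)
  have ind: "vec.independent (insert u B)"
    by (rule vec.independent_insertI) (use B(2) assms(2) VB in simp_all)
  define f where "f x = (if x = u then u else 0)" for x
  obtain h where h: "Vector_Spaces.linear (*s) (*s) h" "\<forall>x\<in>insert u B. h x = f x"
    using vec.linear_independent_extend[OF ind, of f] by metis
  have uB: "u \<notin> B" using assms(2) B(1) by blast
  have "h v = 0" if "v \<in> V" for v
  proof (rule vec.linear_eq_0_on_span[OF h(1)])
    show "h x = 0" if "x \<in> B" for x using h(2) uB that by (auto simp: f_def)
    show "v \<in> vec.span B" using VB \<open>v \<in> V\<close> by simp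
  qed
  moreover have "u \<noteq> 0" using assms vec.subspace_0 by blast
  then have "h u \<noteq> 0" using h(2) by (simp add: f_def)
  ultimately show ?thesis using h(1) by (intro that[of h])
qed

lemma span_Un3_singletons:
  "vec.span (vec.span {u} \<union> vec.span {v} \<union> vec.span {w}) = vec.span {u, v, w}"
proof (rule antisym)
  show "vec.span (vec.span {u} \<union> vec.span {v} \<union> vec.span {w}) \<subseteq> vec.span {u, v, w}"
    by (intro vec.span_minimal Un_least vec.subspace_span) (simp_all add: vec.span_base)
  show "vec.span {u, v, w} \<subseteq> vec.span (vec.span {u} \<union> vec.span {v} \<union> vec.span {w})"
    by (rule vec.span_mono) (auto intro: vec.span_base)
qed

context cubic_extension
begin

lemma power_q3j: "(x :: 'k) ^ (q ^ (3 * j)) = x"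
  by (induction j) (simp_all add: power_add power_mult power_q3)

lemma frob_add: "frob (q ^ j) (x + y) = frob (q ^ j) x + frob (q ^ j) (y :: 'k ^ 'n)"
  by (simp add: frob_def vec_eq_iff power_qj_add)

lemma frob_scale: "frob m (c *s x) = c ^ m *s frob m (x :: 'k ^ 'n)"
  by (simp add: frob_def vec_eq_iff power_mult_distrib)

lemma frob_frob: "frob (q ^ i) (frob (q ^ j) x) = frob (q ^ (i + j)) (x :: 'k ^ 'n)"
  by (simp add: frob_def vec_eq_iff power_add power_mult mult.commute[of "q ^ i"])

lemma frob_add3: "frob (q ^ (j + 3)) x = frob (q ^ j) (x :: 'k ^ 'n)"
  by (simp add: frob_def vec_eq_iff power_add power_mult power_q3)

lemma frob_0: "frob (q ^ 0) x = (x :: 'k ^ 'n)"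
  by (simp add: frob_def vec_eq_iff)

lemma frob_id: "frob (q ^ 0) = (\<lambda>x :: 'k ^ 'n. x)"
  using frob_0 by (rule ext)

lemma frob_zero: "frob (q ^ j) 0 = (0 :: 'k ^ 'n)"
  using q_pos by (simp add: frob_def vec_eq_iff power_0_left)

lemma frob_vecs_over_F: "x \<in> vecs_over F \<Longrightarrow> frob (q ^ j) x = (x :: 'k ^ 'n)"
  by (simp add: frob_def vec_eq_iff vecs_over_def F_power_qj)

lemma vecs_over_F_iff: "x \<in> vecs_over F \<longleftrightarrow> frob q x = (x :: 'k ^ 'n)"
  by (simp add: frob_def vec_eq_iff vecs_over_def F_iff)

lemma frob_image_span: "frob (q ^ j) ` vec.span {v} = vec.span {frob (q ^ j) (v :: 'k ^ 'n)}"
proof -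
  have "range (\<lambda>c :: 'k. c ^ q ^ j) = UNIV"
  proof -
    have "c = (c ^ (q ^ (2 * j))) ^ q ^ j" for c :: 'k
      using power_q3j[of c j] by (simp flip: power_mult power_add)
    then show ?thesis by blast
  qed
  then show ?thesis
    by (auto simp: vec.span_singleton frob_scale image_iff) (metis rangeE UNIV_I)
qed

text \<open>After a linear map that kills \<open>V\<close>, each coordinate is a polynomial in
  \<open>c\<close> with the distinct exponents 1, q and q^2. It has q^3 roots but degree at most
  q^2, so its coefficients vanish.\<close>

lemma additive_poly_in_subspace:
  fixes V :: "('k ^ 'n) set"
  assumes V: "vec.subspace V"
    and u: "\<And>c. c *s u0 + c ^ q *s u1 + c ^ q\<^sup>2 *s u2 \<in> V"
  shows "u0 \<in> V \<and> u1 \<in> V \<and> u2 \<in> V"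
proof (rule ccontr)
  assume "\<not> ?thesis"
  then obtain w where w: "w \<in> {u0, u1, u2}" "w \<notin> V" by blast
  obtain h :: "'k ^ 'n \<Rightarrow> 'k ^ 'n" where h: "Vector_Spaces.linear (*s) (*s) h" "\<And>v. v \<in> V \<Longrightarrow> h v = 0" "h w \<noteq> 0"
    using separating_linear_map[OF V w(2)] by blast
  obtain l where l: "h w $ l \<noteq> 0" using h(3) by (auto simp: vec_eq_iff)
  let ?p = "monom (h u0 $ l) 1 + monom (h u1 $ l) q + monom (h u2 $ l) (q\<^sup>2)"
  have q12: "q < q\<^sup>2" "q\<^sup>2 < q ^ 3" using q_gt_1 by (simp_all add: power2_eq_square power3_eq_cube)
  have "poly ?p c = 0" for c
  proof -
    have "h (c *s u0 + c ^ q *s u1 + c ^ q\<^sup>2 *s u2) = 0" using u h(2) by blast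
    then have "(c *s h u0 + c ^ q *s h u1 + c ^ q\<^sup>2 *s h u2) $ l = 0"
      by (simp only: vec.linear_add[OF h(1)] vec.linear_scale[OF h(1)] zero_index)
    then show ?thesis by (simp add: poly_monom mult.commute)
  qed
  then have roots: "{c. poly ?p c = 0} = UNIV" by simp
  have deg: "degree ?p \<le> q\<^sup>2"
    using q12 q_gt_1 by (intro degree_add_le order_trans[OF degree_monom_le]) auto
  have "?p = 0"
  proof (rule ccontr)
    assume "?p \<noteq> 0"
    then have "card {c. poly ?p c = 0} \<le> degree ?p" by (rule card_poly_roots_bound)
    then show False using deg q12 unfolding roots card_K by linarith
  qed
  then have "coeff ?p 1 = 0" "coeff ?p q = 0" "coeff ?p (q\<^sup>2) = 0" by simp_all
  then have "h u0 $ l = 0" "h u1 $ l = 0" "h u2 $ l = 0"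
    using q12 q_gt_1 by (auto split: if_splits)
  then show False using w(1) l by auto
qed

end

text \<open>\<open>M\<close> is a change of coordinates of the plane; it will be the one that
  carries the standard conic to the given one.\<close>

locale bose = cubic_extension q K for q :: nat and K :: "'k::{field,finite} itself" +
  fixes \<phi> :: "'k ^ 3 \<Rightarrow> 'k ^ 9" and M :: "'k ^ 3 ^ 3"
  assumes \<phi>_linear: "Vector_Spaces.linear (*s) (*s) \<phi>"
    and \<phi>_span: "conj_span q (range \<phi>) = UNIV"
    and M_invertible: "invertible M"
begin

lemma \<phi>_add: "\<phi> (x + y) = \<phi> x + \<phi> y" and \<phi>_scale: "\<phi> (c *s x) = c *s \<phi> x"
  using vec.linear_add[OF \<phi>_linear] vec.linear_scale[OF \<phi>_linear] by simp_all

text \<open>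
  The coordinate maps of the three conjugate planes: \<open>E j\<close> is the \<open>q^j\<close>-conjugate of the linear map
  \<open>\<lambda>x. \<phi> (M *v x)\<close>, since the Frobenius powers on the two sides compose to the identity.
\<close>

definition E :: "nat \<Rightarrow> 'k ^ 3 \<Rightarrow> 'k ^ 9" where
  "E j x = frob (q ^ j) (\<phi> (M *v frob (q ^ (2 * j)) x))"

lemma E_add: "E j (x + y) = E j x + E j y"
  by (simp add: E_def frob_add \<phi>_add matrix_vector_right_distrib)

lemma E_scale: "E j (c *s x) = c *s E j x"
proof -
  have "(c ^ q ^ (2 * j)) ^ q ^ j = c"
    using power_q3j[of c j] by (simp flip: power_mult power_add)
  then show ?thesis by (simp add: E_def frob_scale \<phi>_scale vec.scale)
qed

lemma E_zero: "E j 0 = 0"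
  using E_scale[of j 0 0] by simp

lemma E_0_eq: "E 0 x = \<phi> (M *v x)"
  unfolding E_def mult_0_right frob_0 ..

lemma E_frob: "frob q (E j x) = E (Suc j) (frob q x)"
proof -
  have "frob (q ^ (2 * Suc j)) (frob (q ^ 1) x) = frob (q ^ (2 * j)) x"
  proof -
    have "2 * Suc j + 1 = 2 * j + 3" by simp
    then show ?thesis unfolding frob_frob by (simp only: frob_add3)
  qed
  moreover have "frob (q ^ 1) (frob (q ^ j) y) = frob (q ^ Suc j) y" for y :: "'k ^ 9"
    unfolding frob_frob by simp
  ultimately show ?thesis unfolding E_def by (simp only: power_one_right)
qed

lemma E_add3: "E (j + 3) = E j"
proof
  fix x :: "'k ^ 3"
  have "2 * (j + 3) = 2 * j + 3 + 3" by simp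
  then have "frob (q ^ (2 * (j + 3))) x = frob (q ^ (2 * j)) x" by (simp only: frob_add3)
  then show "E (j + 3) x = E j x" unfolding E_def frob_add3 by simp
qed

lemma range_E: "range (E j) = frob (q ^ j) ` range \<phi>"
proof (intro equalityI subsetI)
  fix u assume "u \<in> frob (q ^ j) ` range \<phi>"
  then obtain y where y: "u = frob (q ^ j) (\<phi> y)" by blast
  obtain x where x: "y = M *v x" using M_invertible by (rule invertible_surjE)
  have "frob (q ^ (2 * j)) (frob (q ^ j) x) = x"
    unfolding frob_frob using power_q3j by (simp add: frob_def vec_eq_iff)
  then have "u = E j (frob (q ^ j) x)" by (simp add: E_def x y)
  then show "u \<in> range (E j)" by blast
qed (auto simp: E_def)

lemma E_decompose: "\<exists>x y z. u = E 0 x + E 1 y + E 2 z"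
proof -
  let ?T = "{E 0 x + E 1 y + E 2 z | x y z. True}"
  have "vec.subspace ?T"
    unfolding vec.subspace_def
  proof (intro conjI ballI allI)
    show "0 \<in> ?T" using E_zero by (intro CollectI exI[of _ 0]) simp
    fix u v assume "u \<in> ?T" "v \<in> ?T"
    then obtain x y z x' y' z' where "u = E 0 x + E 1 y + E 2 z" "v = E 0 x' + E 1 y' + E 2 z'" by blast
    then have "u + v = E 0 (x + x') + E 1 (y + y') + E 2 (z + z')" by (simp add: E_add)
    then show "u + v \<in> ?T" by blast
  next
    fix c u assume "u \<in> ?T"
    then obtain x y z where "u = E 0 x + E 1 y + E 2 z" by blast
    then have "c *s u = E 0 (c *s x) + E 1 (c *s y) + E 2 (c *s z)"
      by (simp add: E_scale vec.scale_right_distrib)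
    then show "c *s u \<in> ?T" by blast
  qed
  moreover have "range (E 0) \<subseteq> ?T" "range (E 1) \<subseteq> ?T" "range (E 2) \<subseteq> ?T"
  proof -
    have "E 0 x \<in> ?T" for x by (intro CollectI exI[of _ x] exI[of _ 0]) (simp add: E_zero)
    moreover have "E 1 x \<in> ?T" for x by (intro CollectI exI[of _ 0] exI[of _ x]) (simp add: E_zero)
    moreover have "E 2 x \<in> ?T" for x by (rule CollectI, rule exI[of _ 0], rule exI[of _ 0], rule exI[of _ x]) (simp add: E_zero)
    ultimately show "range (E 0) \<subseteq> ?T" "range (E 1) \<subseteq> ?T" "range (E 2) \<subseteq> ?T" by blast+
  qed
  then have "range \<phi> \<union> frob q ` range \<phi> \<union> frob (q\<^sup>2) ` range \<phi> \<subseteq> ?T"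
    unfolding range_E frob_id image_ident power_one_right by blast
  ultimately have "conj_span q (range \<phi>) \<subseteq> ?T" unfolding conj_span_def by (intro vec.span_minimal)
  then show ?thesis using \<phi>_span by blast
qed

text \<open>The map from triples to sums is onto by \<open>E_decompose\<close>, and 3 + 3 + 3 = 9
  makes the two finite sets equally large, so it is injective.\<close>

lemma E_indep: "E 0 x + E 1 y + E 2 z = 0 \<Longrightarrow> x = 0 \<and> y = 0 \<and> z = 0"
proof -
  assume 0: "E 0 x + E 1 y + E 2 z = 0"
  let ?T = "\<lambda>(x, y, z). E 0 x + E 1 y + E 2 z"
  have "range ?T = UNIV"
  proof -
    have "u \<in> range ?T" for u
    proof -
      obtain x y z where "u = E 0 x + E 1 y + E 2 z" using E_decompose by blast
      then have "u = ?T (x, y, z)" by simp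
      then show ?thesis by blast
    qed
    then show ?thesis by blast
  qed
  moreover have "CARD(('k ^ 3) \<times> ('k ^ 3) \<times> ('k ^ 3)) = CARD('k ^ 9)"
  proof -
    have "c ^ 3 * (c ^ 3 * c ^ 3) = c ^ 9" for c :: nat by (simp flip: power_add)
    then show ?thesis by (simp only: card_prod CARD_vec card_bit1 card_bit0 card_num1) simp
  qed
  ultimately have "card (range ?T) = CARD(('k ^ 3) \<times> ('k ^ 3) \<times> ('k ^ 3))" by (simp only:)
  then have "inj ?T" by (intro eq_card_imp_inj_on) simp_all
  moreover have "?T (x, y, z) = ?T (0, 0, 0)" using 0 by (simp add: E_zero)
  ultimately have "(x, y, z) = (0, 0, 0)" by (rule injD)
  then show ?thesis by simp
qed

lemma E_unique:
  assumes "E 0 x + E 1 y + E 2 z = E 0 x' + E 1 y' + E 2 z'"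
  shows "x = x' \<and> y = y' \<and> z = z'"
proof -
  have m: "E j (a - b) = E j a - E j b" for j a b using E_add[of j "a - b" b] by simp
  have "E 0 (x - x') + E 1 (y - y') + E 2 (z - z') = 0" using assms by (simp add: m algebra_simps)
  then show ?thesis using E_indep by fastforce
qed

text \<open>Frobenius fixes \<open>x\<close>, so the conjugates of \<open>\<phi> (M *v x)\<close>
  are the \<open>E j x\<close>: at a subplane point the spread plane is the scroll-plane.\<close>

lemma conj_span_point:
  assumes "x \<in> vecs_over F"
  shows "conj_span q (\<phi> ` vec.span {M *v x}) = vec.span {E 0 x, E 1 x, E 2 x}"
proof -
  have \<phi>: "\<phi> ` vec.span {y} = vec.span {\<phi> y}" for y
    by (auto simp: vec.span_singleton \<phi>_scale image_iff)
  have "frob q ` vec.span {\<phi> (M *v x)} = vec.span {E 1 x}"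
    "frob (q\<^sup>2) ` vec.span {\<phi> (M *v x)} = vec.span {E 2 x}"
    using frob_image_span[of 1 "\<phi> (M *v x)"] frob_image_span[of 2 "\<phi> (M *v x)"] assms
    by (simp_all add: E_def frob_vecs_over_F)
  then show ?thesis unfolding conj_span_def \<phi> span_Un3_singletons[symmetric] by (simp add: E_0_eq)
qed

text \<open>In the coordinates of \<open>M\<close> the collineation is the Frobenius map. Its
  exponents 2 and 1 in \<open>scroll_plane\<close> match the inner powers q^2 and q^4 in
  \<open>E 1\<close> and \<open>E 2\<close>, as q^4 acts like q.\<close>

lemma scroll_plane_point:
  assumes B: "\<And>y. B *v frob q (M *v y) = \<mu> *s (M *v frob q y)" and "\<mu> \<noteq> 0"
  shows "scroll_plane q \<phi> B (vec.span {M *v x}) = vec.span {E 0 x, E 1 x, E 2 x}"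
proof -
  have \<phi>: "\<phi> ` vec.span {y} = vec.span {\<phi> y}" for y
    by (auto simp: vec.span_singleton \<phi>_scale image_iff)
  have coll: "semilinear_coll q B (vec.span {M *v y}) = vec.span {M *v frob q y}" for y
  proof -
    have "semilinear_coll q B (vec.span {M *v y}) = (\<lambda>v. B *v v) ` frob (q ^ 1) ` vec.span {M *v y}"
      by (simp add: semilinear_coll_def image_image)
    also have "\<dots> = vec.span {B *v frob q (M *v y)}"
      unfolding frob_image_span using homography_span_singleton[of B "frob (q ^ 1) (M *v y)"]
      by (simp add: homography_def)
    also have "\<dots> = vec.span {M *v frob q y}" using assms(2) by (simp add: B span_singleton_scale)
    finally show ?thesis .
  qed
  have q2: "frob q (frob q x) = frob (q\<^sup>2) x"
    using frob_frob[of 1 1 x] by (simp add: power2_eq_square)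
  have q4: "frob (q ^ 4) x = frob q x" using frob_add3[of 1 x] by simp
  have "frob q ` vec.span {\<phi> (M *v frob (q\<^sup>2) x)} = vec.span {E 1 x}"
    "frob (q\<^sup>2) ` vec.span {\<phi> (M *v frob q x)} = vec.span {E 2 x}"
    using frob_image_span[of 1 "\<phi> (M *v frob (q\<^sup>2) x)"] frob_image_span[of 2 "\<phi> (M *v frob q x)"]
    by (simp_all add: E_def q4)
  moreover have "(semilinear_coll q B ^^ 2) P = semilinear_coll q B (semilinear_coll q B P)" for P
    by (simp add: numeral_2_eq_2)
  ultimately show ?thesis
    unfolding scroll_plane_def span_Un3_singletons[symmetric] by (simp only: coll \<phi> q2 E_0_eq)
qed

end

context cubic_extension
begin

lemma conj_span_of_span:
  fixes \<phi> :: "'k ^ 3 \<Rightarrow> 'k ^ 9"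
  assumes "Vector_Spaces.linear (*s) (*s) \<phi>"
  shows "conj_span q (\<phi> ` vec.span A) \<subseteq> conj_span q (\<phi> ` A)"
proof -
  have *: "frob (q ^ j) (\<phi> x) \<in> vec.span (frob (q ^ j) ` \<phi> ` A)" if "x \<in> vec.span A" for j x
    using that
  proof (induction rule: vec.span_induct_alt)
    case base
    then show ?case using vec.linear_0[OF assms] by (simp add: frob_zero vec.span_zero)
  next
    case (step c a y)
    have "frob (q ^ j) (\<phi> (c *s a + y)) = c ^ q ^ j *s frob (q ^ j) (\<phi> a) + frob (q ^ j) (\<phi> y)"
      by (simp add: vec.linear_add[OF assms] vec.linear_scale[OF assms] frob_add frob_scale)
    then show ?case using step by (simp add: vec.span_add vec.span_scale vec.span_base)
  qed
  have sub: "vec.span (frob (q ^ j) ` \<phi> ` A) \<subseteq> conj_span q (\<phi> ` A)" if "j \<in> {0, 1, 2}" for j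
    unfolding conj_span_def using that
    by (intro vec.span_mono) (elim insertE emptyE; simp only: frob_id image_ident power_one_right; blast)
  have "frob (q ^ j) ` \<phi> ` vec.span A \<subseteq> conj_span q (\<phi> ` A)" if "j \<in> {0, 1, 2}" for j
    using * sub[OF that] by blast
  from this[of 0] this[of 1] this[of 2]
  have "\<phi> ` vec.span A \<union> frob q ` \<phi> ` vec.span A \<union> frob (q\<^sup>2) ` \<phi> ` vec.span A \<subseteq> conj_span q (\<phi> ` A)"
    unfolding frob_id image_ident power_one_right by blast
  then show ?thesis unfolding conj_span_def[of q "\<phi> ` vec.span A"]
    by (rule vec.span_minimal) (simp add: conj_span_def vec.subspace_span)
qed

text \<open>Three conjugates of a basis of two vectors span the space. The bound shows that the
  six-space is not contained in it.\<close>

lemma dim_conj_span_line: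
  fixes \<phi> :: "'k ^ 3 \<Rightarrow> 'k ^ 9"
  assumes lin: "Vector_Spaces.linear (*s) (*s) \<phi>" and L: "vec.subspace L" "vec.dim L = 2"
  shows "vec.dim (conj_span q (\<phi> ` L)) \<le> 6"
proof -
  obtain A where A: "A \<subseteq> L" "vec.independent A" "L \<subseteq> vec.span A" "card A = 2"
    using vec.basis_exists[of L] L(2) by metis
  have "L = vec.span A" using A(3) vec.span_minimal[OF A(1) L(1)] by (rule antisym)
  then have "conj_span q (\<phi> ` L) \<subseteq> vec.span (\<phi> ` A \<union> frob q ` \<phi> ` A \<union> frob (q\<^sup>2) ` \<phi> ` A)" (is "_ \<subseteq> vec.span ?S")
    using conj_span_of_span[OF lin, of A] by (simp only: conj_span_def)
  then have "vec.dim (conj_span q (\<phi> ` L)) \<le> card ?S" by (rule vec.dim_le_card) simp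
  also have "\<dots> \<le> card (\<phi> ` A) + card (frob q ` \<phi> ` A) + card (frob (q\<^sup>2) ` \<phi> ` A)"
    by (meson add_le_mono card_Un_le le_refl le_trans)
  also have "\<dots> \<le> 2 + 2 + 2"
    using A(4) by (intro add_mono) (metis card_image_le finite le_trans)+
  finally show ?thesis by simp
qed

end

context bose
begin

lemma lin_form_frob_power: "lin_form \<alpha> j (frob (q ^ j) x) = lin_form \<alpha> 0 x ^ (q ^ j)"
  by (simp add: lin_form_def frob_def power_qj_sum power_mult_distrib)

text \<open>\<open>L\<close> and \<open>M *v e\<close> span the whole space; the form is the
  coefficient of \<open>M *v e\<close> modulo \<open>L\<close>.\<close>

lemma linear_form_exists:
  assumes L: "vec.subspace L" "vec.dim L = 2" and e: "M *v e \<notin> L"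
  obtains \<alpha> where "\<And>x. lin_form \<alpha> 0 x = 0 \<longleftrightarrow> M *v x \<in> L" "lin_form \<alpha> 0 e = 1"
proof -
  have span: "vec.span L = L" using L(1) by (simp only: vec.span_eq_iff)
  have "M *v e \<notin> vec.span L" using e unfolding span .
  then have "vec.dim (insert (M *v e) L) = 3" using L(2) by (simp add: vec.dim_insert)
  then have "vec.span (insert (M *v e) L) = UNIV"
    using vec.dim_eq_full[of "insert (M *v e) L"] by (simp add: vec.dimension_def card_cart_basis)
  then have "\<forall>x. \<exists>k. M *v x - k *s (M *v e) \<in> L" using vec.span_insert[of "M *v e" L] span by blast
  then obtain \<kappa> where \<kappa>: "M *v x - \<kappa> x *s (M *v e) \<in> L" for x by metis
  have unique: "\<kappa> x = k" if "M *v x - k *s (M *v e) \<in> L" for x k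
  proof (rule ccontr)
    assume ne: "\<kappa> x \<noteq> k"
    have "(M *v x - k *s (M *v e)) - (M *v x - \<kappa> x *s (M *v e)) \<in> L"
      by (rule vec.subspace_diff[OF L(1) that \<kappa>])
    also have "(M *v x - k *s (M *v e)) - (M *v x - \<kappa> x *s (M *v e)) = (\<kappa> x - k) *s (M *v e)"
      by (simp add: vec.scale_left_diff_distrib)
    finally have "(1 / (\<kappa> x - k)) *s ((\<kappa> x - k) *s (M *v e)) \<in> L" by (rule vec.subspace_scale[OF L(1)])
    moreover have "(1 / (\<kappa> x - k)) *s ((\<kappa> x - k) *s (M *v e)) = M *v e"
      unfolding vec.scale_scale using ne by (simp del: vec.scale_left_diff_distrib)
    ultimately show False using e by (simp only:)
  qed
  have add: "\<kappa> (x + y) = \<kappa> x + \<kappa> y" for x y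
  proof (rule unique)
    have "(M *v x - \<kappa> x *s (M *v e)) + (M *v y - \<kappa> y *s (M *v e)) \<in> L"
      by (rule vec.subspace_add[OF L(1) \<kappa> \<kappa>])
    then show "M *v (x + y) - (\<kappa> x + \<kappa> y) *s (M *v e) \<in> L"
      by (simp add: matrix_vector_right_distrib vec.scale_left_distrib algebra_simps)
  qed
  have scale: "\<kappa> (c *s x) = c * \<kappa> x" for c x
  proof (rule unique)
    have "c *s (M *v x - \<kappa> x *s (M *v e)) \<in> L" by (rule vec.subspace_scale[OF L(1) \<kappa>])
    then show "M *v (c *s x) - (c * \<kappa> x) *s (M *v e) \<in> L"
      by (simp add: vec.scale vec.scale_right_diff_distrib)
  qed
  define \<alpha> where "\<alpha> = (\<chi> i. \<kappa> (axis i 1))"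
  have form: "lin_form \<alpha> 0 x = \<kappa> x" for x
  proof -
    have "x = x $ 1 *s axis 1 1 + x $ 2 *s axis 2 1 + x $ 3 *s axis 3 1"
      by (simp add: vec3_eq_iff axis_def)
    then have "\<kappa> x = \<kappa> (x $ 1 *s axis 1 1 + x $ 2 *s axis 2 1 + x $ 3 *s axis 3 1)" by simp
    then show ?thesis by (simp add: add scale lin_form_def sum_3 \<alpha>_def mult.commute)
  qed
  have "lin_form \<alpha> 0 x = 0 \<longleftrightarrow> M *v x \<in> L" for x
    using unique[of x 0] \<kappa>[of x] by (auto simp: form)
  moreover have "lin_form \<alpha> 0 e = 1"
    unfolding form by (rule unique) (simp add: vec.subspace_0[OF L(1)])
  ultimately show ?thesis by (rule that)
qed

text \<open>
  The vectors over \<open>F\<close> in the span of the conjugates of \<open>\<phi> ` L\<close> are enough to generate it: they contain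
  \<open>c *s u + c^q *s u' + c^(q^2) *s u''\<close> for all \<open>c\<close>.
\<close>

lemma conj_span_subset:
  assumes L: "vec.subspace L" and V: "vec.subspace V"
    and sub: "pts (conj_span q (\<phi> ` L)) \<inter> PG F \<subseteq> pts V"
  shows "conj_span q (\<phi> ` L) \<subseteq> V"
proof -
  have W: "vec.subspace (conj_span q (\<phi> ` L))" by (simp add: conj_span_def vec.subspace_span)
  have all: "\<phi> x \<in> V \<and> frob q (\<phi> x) \<in> V \<and> frob (q\<^sup>2) (\<phi> x) \<in> V" if x: "x \<in> L" for x
  proof (rule additive_poly_in_subspace[OF V])
    fix c :: 'k
    let ?y = "\<phi> (c *s x)"
    let ?u = "?y + frob q ?y + frob (q\<^sup>2) ?y"
    have u: "c *s \<phi> x + c ^ q *s frob q (\<phi> x) + c ^ q\<^sup>2 *s frob (q\<^sup>2) (\<phi> x) = ?u"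
      by (simp add: \<phi>_scale frob_scale)
    have fr: "frob q (frob q ?y) = frob (q\<^sup>2) ?y" "frob q (frob (q\<^sup>2) ?y) = ?y"
      using frob_frob[of 1 1 ?y] frob_frob[of 1 2 ?y] frob_add3[of 0 ?y] frob_0[of ?y]
      by (simp_all add: power2_eq_square power3_eq_cube mult.assoc)
    have add: "frob q (a + b) = frob q a + frob q b" for a b :: "'k ^ 9"
      using frob_add[of 1 a b] by simp
    have "frob q ?u = ?u" unfolding add fr by (simp add: add_ac)
    then have uF: "?u \<in> vecs_over F" by (simp add: vecs_over_F_iff)
    have "c *s x \<in> L" using L x by (rule vec.subspace_scale)
    then have "?y \<in> conj_span q (\<phi> ` L)" "frob q ?y \<in> conj_span q (\<phi> ` L)" "frob (q\<^sup>2) ?y \<in> conj_span q (\<phi> ` L)"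
      unfolding conj_span_def by (blast intro: vec.span_base)+
    then have uW: "?u \<in> conj_span q (\<phi> ` L)" by (intro vec.subspace_add[OF W])
    have "?u \<in> V"
    proof (cases "?u = 0")
      case True
      then show ?thesis using vec.subspace_0[OF V] by (simp only:)
    next
      case False
      then have "vec.span {?u} \<in> pts (conj_span q (\<phi> ` L)) \<inter> PG F"
        unfolding pts_eq[OF W] using uF uW by (auto simp: PG_def)
      then have "vec.span {?u} \<subseteq> V" using sub by (auto simp: pts_def)
      then show ?thesis using vec.span_base[of ?u "{?u}"] by blast
    qed
    then show "c *s \<phi> x + c ^ q *s frob q (\<phi> x) + c ^ q\<^sup>2 *s frob (q\<^sup>2) (\<phi> x) \<in> V" unfolding u .
  qed
  show ?thesis
    unfolding conj_span_def by (rule vec.span_minimal[OF _ V]) (use all in blast)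
qed

text \<open>Some \<open>d\<close> in \<open>D\<close> lies outside the space at infinity, and the
  form is scaled so that all three conjugates are 1 at \<open>d\<close>. A vector with equal values
  \<open>k\<close> differs from \<open>k *s d\<close> by a vector at infinity, hence lies in the
  span of \<open>D\<close>; equality follows because both spaces have dimension 7.\<close>

lemma six_space_equation:
  assumes L: "vec.subspace L" "vec.dim L = 2"
    and D: "D \<subseteq> vecs_over F" "vec.independent D" "card D = 7"
    and sub: "pts (conj_span q (\<phi> ` L)) \<inter> PG F \<subseteq> pts (vec.span D)"
  obtains \<alpha> where "\<forall>x. lin_form \<alpha> 0 x = 0 \<longleftrightarrow> M *v x \<in> L"
    "\<forall>x y z. E 0 x + E 1 y + E 2 z \<in> vec.span D \<longleftrightarrow>
      lin_form \<alpha> 0 x = lin_form \<alpha> 1 y \<and> lin_form \<alpha> 1 y = lin_form \<alpha> 2 z"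
proof -
  let ?W = "conj_span q (\<phi> ` L)"
  have W: "vec.subspace ?W" by (simp add: conj_span_def vec.subspace_span)
  have WD: "?W \<subseteq> vec.span D" by (rule conj_span_subset[OF L(1) vec.subspace_span sub])
  have dimD: "vec.dim (vec.span D) = 7" using vec.dim_span_eq_card_independent[OF D(2)] D(3) by simp
  have "\<not> D \<subseteq> ?W"
  proof
    assume "D \<subseteq> ?W"
    then have "vec.span D \<subseteq> ?W" using W by (rule vec.span_minimal)
    then have "vec.dim (vec.span D) \<le> vec.dim ?W" by (rule vec.dim_subset)
    then show False using dimD dim_conj_span_line[OF \<phi>_linear L] by simp
  qed
  then obtain d where d: "d \<in> D" "d \<notin> ?W" by blast
  obtain e y z where dz: "d = E 0 e + E 1 y + E 2 z" using E_decompose by blast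
  \<comment> \<open>Frobenius fixes \<open>d\<close> and shifts the three components cyclically;
    uniqueness of the decomposition makes them conjugates of \<open>e\<close>.\<close>
  have "frob q d = d" using d D(1) vecs_over_F_iff by blast
  moreover have "frob q d = E 0 (frob q z) + E 1 (frob q e) + E 2 (frob q y)"
  proof -
    have add: "frob q (a + b) = frob q a + frob q b" for a b :: "'k ^ 9"
      using frob_add[of 1 a b] by simp
    have "E (Suc 2) = E 0" "Suc 0 = 1" "Suc 1 = 2" using E_add3[of 0] by (simp_all add: numeral_3_eq_3 numeral_2_eq_2)
    then show ?thesis unfolding dz add E_frob by (simp only: add_ac)
  qed
  ultimately have "y = frob q e" "z = frob q y" using E_unique dz by metis+
  then have yz: "y = frob (q ^ 1) e" "z = frob (q ^ 2) e"
    using frob_frob[of 1 1 e] by (simp_all add: power2_eq_square)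
  have EW: "E j x \<in> ?W" if "M *v frob (q ^ (2 * j)) x \<in> L" "j \<in> {0, 1, 2}" for j x
  proof -
    have "E j x \<in> frob (q ^ j) ` \<phi> ` L" unfolding E_def using that(1) by blast
    then have "E j x \<in> \<phi> ` L \<union> frob q ` \<phi> ` L \<union> frob (q\<^sup>2) ` \<phi> ` L"
      using that(2) by (elim insertE emptyE; simp only: frob_id image_ident power_one_right; blast)
    then show ?thesis unfolding conj_span_def by (rule vec.span_base)
  qed
  have frob_inv: "frob (q ^ (2 * j)) (frob (q ^ j) x) = (x :: 'k ^ 3)" for j x
    unfolding frob_frob using power_q3j by (simp add: frob_def vec_eq_iff)
  have e: "M *v e \<notin> L"
  proof
    assume eL: "M *v e \<in> L"
    have "E 0 (frob (q ^ 0) e) \<in> ?W" "E 1 (frob (q ^ 1) e) \<in> ?W" "E 2 (frob (q ^ 2) e) \<in> ?W"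
      by (rule EW, unfold frob_inv, rule eL, simp)+
    then have "d \<in> ?W" unfolding dz yz frob_0 by (intro vec.subspace_add[OF W])
    then show False using d by blast
  qed
  obtain \<alpha> where \<alpha>: "\<And>x. lin_form \<alpha> 0 x = 0 \<longleftrightarrow> M *v x \<in> L" "lin_form \<alpha> 0 e = 1"
    using linear_form_exists[OF L e] by blast
  have lf: "lin_form \<alpha> 1 y = 1" "lin_form \<alpha> 2 z = 1"
    unfolding yz lin_form_frob_power by (simp_all add: \<alpha>)
  have EW': "E j x \<in> ?W" if "lin_form \<alpha> j x = 0" "j \<in> {0, 1, 2}" for j x
  proof (rule EW[OF _ that(2)])
    have "frob (q ^ j) (frob (q ^ (2 * j)) x) = x"
      unfolding frob_frob using power_q3j[of _ j] by (simp add: frob_def vec_eq_iff)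
    then have "lin_form \<alpha> 0 (frob (q ^ (2 * j)) x) ^ (q ^ j) = 0"
      using lin_form_frob_power[of \<alpha> j "frob (q ^ (2 * j)) x"] that(1) by simp
    then show "M *v frob (q ^ (2 * j)) x \<in> L" using \<alpha>(1) by simp
  qed
  define H where "H = {u. \<exists>x y z. u = E 0 x + E 1 y + E 2 z \<and>
      lin_form \<alpha> 0 x = lin_form \<alpha> 1 y \<and> lin_form \<alpha> 1 y = lin_form \<alpha> 2 z}"
  have diff: "E j (a - b) = E j a - E j b" for j a b using E_add[of j "a - b" b] by simp
  have lf_diff: "lin_form \<alpha> j (a - b) = lin_form \<alpha> j a - lin_form \<alpha> j b" for j a b
    using lin_form_linear(1)[of \<alpha> j "a - b" b] by simp
  have "H \<subseteq> vec.span D"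
  proof
    fix u assume "u \<in> H"
    then obtain x y' z' where u: "u = E 0 x + E 1 y' + E 2 z'"
      "lin_form \<alpha> 0 x = lin_form \<alpha> 1 y'" "lin_form \<alpha> 1 y' = lin_form \<alpha> 2 z'" unfolding H_def by blast
    define k where "k = lin_form \<alpha> 0 x"
    have "E 0 (x - k *s e) \<in> ?W" "E 1 (y' - k *s y) \<in> ?W" "E 2 (z' - k *s z) \<in> ?W"
      using u lf \<alpha>(2) by (intro EW'; simp add: lf_diff lin_form_linear k_def)+
    then have "E 0 (x - k *s e) + E 1 (y' - k *s y) + E 2 (z' - k *s z) \<in> vec.span D"
      using WD by (intro vec.span_add) blast+
    moreover have "k *s d \<in> vec.span D" using d by (intro vec.span_scale vec.span_base)
    ultimately have "E 0 (x - k *s e) + E 1 (y' - k *s y) + E 2 (z' - k *s z) + k *s d \<in> vec.span D"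
      by (rule vec.span_add)
    moreover have "E 0 (x - k *s e) + E 1 (y' - k *s y) + E 2 (z' - k *s z) + k *s d = u"
      unfolding dz u by (simp add: diff E_scale vec.scale_right_distrib)
    ultimately show "u \<in> vec.span D" by simp
  qed
  moreover have "vec.subspace H"
    unfolding vec.subspace_def
  proof (intro conjI ballI allI)
    show "0 \<in> H" unfolding H_def by (intro CollectI exI[of _ 0]) (simp add: E_zero lin_form_linear)
    fix u v assume "u \<in> H" "v \<in> H"
    then obtain x y z x' y' z' where "u = E 0 x + E 1 y + E 2 z" "v = E 0 x' + E 1 y' + E 2 z'"
      "lin_form \<alpha> 0 x = lin_form \<alpha> 1 y" "lin_form \<alpha> 1 y = lin_form \<alpha> 2 z"
      "lin_form \<alpha> 0 x' = lin_form \<alpha> 1 y'" "lin_form \<alpha> 1 y' = lin_form \<alpha> 2 z'" unfolding H_def by blast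
    then show "u + v \<in> H" unfolding H_def
      by (intro CollectI exI[of _ "x + x'"] exI[of _ "y + y'"] exI[of _ "z + z'"])
        (simp add: E_add lin_form_linear)
  next
    fix c u assume "u \<in> H"
    then obtain x y z where "u = E 0 x + E 1 y + E 2 z"
      "lin_form \<alpha> 0 x = lin_form \<alpha> 1 y" "lin_form \<alpha> 1 y = lin_form \<alpha> 2 z" unfolding H_def by blast
    then show "c *s u \<in> H" unfolding H_def
      by (intro CollectI exI[of _ "c *s x"] exI[of _ "c *s y"] exI[of _ "c *s z"])
        (simp add: E_scale lin_form_linear vec.scale_right_distrib)
  qed
  moreover have "7 \<le> vec.dim H"
  proof -
    \<comment> \<open>Two vectors, on which one form is 1 and the other two are 0, correct any
      \<open>u\<close> to have equal values, so the codimension is at most 2.\<close>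
    have "u \<in> vec.span (insert (E 1 y) (insert (E 2 z) H))" for u
    proof -
      obtain x y' z' where u: "u = E 0 x + E 1 y' + E 2 z'" using E_decompose by blast
      define a b where "a = lin_form \<alpha> 1 y' - lin_form \<alpha> 0 x" and "b = lin_form \<alpha> 2 z' - lin_form \<alpha> 0 x"
      define h where "h = E 0 x + E 1 (y' - a *s y) + E 2 (z' - b *s z)"
      have "h \<in> H"
        unfolding H_def h_def using lf
        by (intro CollectI exI[of _ x] exI[of _ "y' - a *s y"] exI[of _ "z' - b *s z"])
          (simp add: lf_diff lin_form_linear a_def b_def)
      moreover have "u = a *s E 1 y + (b *s E 2 z + h)"
        by (simp add: u h_def diff E_scale)
      ultimately show ?thesis
        by (simp add: vec.span_add vec.span_scale vec.span_base)
    qed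
    then have "vec.span (insert (E 1 y) (insert (E 2 z) H)) = UNIV" by blast
    then have "vec.dim (insert (E 1 y) (insert (E 2 z) H)) = 9"
      using vec.dim_span[of "insert (E 1 y) (insert (E 2 z) H)"] by (simp add: vec.dim_UNIV card_cart_basis)
    then show ?thesis by (simp add: vec.dim_insert split: if_splits)
  qed
  ultimately have HD: "H = vec.span D"
    using dimD by (intro vec.subspace_dim_equal vec.subspace_span) simp_all
  have "E 0 x + E 1 y + E 2 z \<in> vec.span D \<longleftrightarrow>
      lin_form \<alpha> 0 x = lin_form \<alpha> 1 y \<and> lin_form \<alpha> 1 y = lin_form \<alpha> 2 z" for x y z
    unfolding HD[symmetric] H_def using E_unique by blast
  then show ?thesis using \<alpha>(1) by (intro that[of \<alpha>] allI)
qed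

end

section \<open>The conjugacy collineation in coordinates of the subplane\<close>

context cubic_extension
begin

lemma frob_matrix_mult:
  "frob q (M *v x) = (\<chi> i j. (M $ i $ j) ^ q) *v frob q (x :: 'k ^ 'n)"
  by (simp add: frob_def vec_eq_iff matrix_vector_mult_def power_q_sum power_mult_distrib)

lemma conic_vecs_F: "w \<in> conic_vecs F \<Longrightarrow> w \<in> vecs_over F"
  by (auto simp: conic_vecs_def vecs_over_def forall_3)

text \<open>
  Since \<open>B\<close> fixes the points of the subplane, the linear map \<open>x \<mapsto> B *v frob q (M *v x)\<close> on the vectors
  over \<open>F\<close> agrees with \<open>M\<close> projectively, hence up to a scalar.
\<close>

lemma conjugacy_scalar:
  fixes B M :: "'k ^ 3 ^ 3"
  assumes M: "invertible M" and B: "invertible B"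
    and B_fix: "\<And>x. x \<in> vecs_over F \<Longrightarrow> x \<noteq> 0 \<Longrightarrow>
      semilinear_coll q B (vec.span {M *v x}) = vec.span {M *v x}"
  obtains \<mu> where "\<mu> \<noteq> 0" "\<forall>y. B *v frob q (M *v y) = \<mu> *s (M *v frob q y)"
proof -
  define R where "R = B ** (\<chi> i j. (M $ i $ j) ^ q)"
  have R: "B *v frob q (M *v y) = R *v frob q y" for y
    unfolding R_def frob_matrix_mult by (simp add: matrix_vector_mul_assoc)
  have ex: "\<exists>c. R *v x = c *s (M *v x)" if x: "x \<in> vecs_over F" "x \<noteq> 0" for x
  proof -
    have "B *v frob q (M *v x) \<in> semilinear_coll q B (vec.span {M *v x})"
      unfolding semilinear_coll_def by (rule imageI) (simp add: vec.span_base)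
    then have "R *v frob q x \<in> vec.span {M *v x}" unfolding R B_fix[OF x] .
    moreover have "frob q x = x" using x(1) vecs_over_F_iff by blast
    ultimately show ?thesis by (auto simp: vec.span_singleton)
  qed
  have axF: "axis i 1 \<in> vecs_over F" "axis i (1 :: 'k) \<noteq> 0" for i :: 3
    by (auto simp: vecs_over_def axis_def vec_eq_iff)
  obtain c where c: "R *v axis i 1 = c i *s (M *v axis i 1)" for i
    using ex[OF axF] by metis
  \<comment> \<open>The all-ones vector completes the axes to a frame and forces the three factors
    \<open>c i\<close> to agree.\<close>
  have "(1 :: 'k ^ 3) \<in> vecs_over F" "(1 :: 'k ^ 3) \<noteq> 0" by (simp_all add: vecs_over_def)
  then obtain \<mu> where \<mu>: "R *v 1 = \<mu> *s (M *v 1)" using ex by blast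
  have decomp: "x = x $ 1 *s axis 1 1 + x $ 2 *s axis 2 1 + x $ 3 *s axis 3 1" for x :: "'k ^ 3"
    by (simp add: vec3_eq_iff axis_def)
  have lin: "N *v x = x $ 1 *s (N *v axis 1 1) + x $ 2 *s (N *v axis 2 1) + x $ 3 *s (N *v axis 3 1)"
    for N :: "'k ^ 3 ^ 3" and x
    by (subst (1) decomp) (simp only: matrix_vector_right_distrib vec.scale)
  have "M *v vector [c 1 - \<mu>, c 2 - \<mu>, c 3 - \<mu>] = R *v 1 - \<mu> *s (M *v 1)"
    unfolding lin[of R 1] lin[of M 1] lin[of M "vector [c 1 - \<mu>, c 2 - \<mu>, c 3 - \<mu>]"] c
    by (simp add: vec3_eq_iff algebra_simps)
  then have "vector [c 1 - \<mu>, c 2 - \<mu>, c 3 - \<mu>] = (0 :: 'k ^ 3)"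
    using M \<mu> unfolding invertible_iff_ker by simp
  then have c\<mu>: "c 1 = \<mu>" "c 2 = \<mu>" "c 3 = \<mu>" by (simp_all add: vec3_eq_iff)
  have RM: "R *v x = \<mu> *s (M *v x)" for x
    unfolding lin[of R x] lin[of M x] c c\<mu> by (simp add: vec3_eq_iff algebra_simps)
  have "\<mu> \<noteq> 0"
  proof
    assume "\<mu> = 0"
    then have "B *v frob q (M *v axis 1 1) = 0" unfolding R RM by simp
    then have "frob q (M *v axis 1 1) = 0" using B unfolding invertible_iff_ker by blast
    then have "M *v axis 1 1 = 0" using q_pos by (simp add: frob_def vec_eq_iff)
    then show False using M axF(2) unfolding invertible_iff_ker by blast
  qed
  then show ?thesis using that[of \<mu>] R RM by simp
qed

end

section \<open>Translation of the geometric data into the algebraic setting\<close>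

theorem theorem4p5:
  fixes q :: nat
    and \<Gamma> :: "('k::{field,finite} ^ 9) set"
    and \<phi> :: "'k ^ 3 \<Rightarrow> 'k ^ 9"
    and l_inf :: "('k ^ 3) set"
    and \<Sigma>6 :: "('k ^ 9) set set"
    and S C C_plus :: "('k ^ 3) set set"
    and B :: "'k ^ 3 ^ 3"
  assumes "primepow q" and "q \<ge> 6" and "CARD('k) = q ^ 3"
    and "bose_embedding q \<Gamma> \<phi>"
    and "pg_subspace 1 l_inf"
    and "subgeom_space (Fq q) 6 \<Sigma>6"
    and "bose_space q (\<phi> ` l_inf) \<subseteq> \<Sigma>6"
    and "subplane_of_order q S"
    and "pts l_inf \<inter> S = {}"
    and "Fq_conic_in q S C"
    and "nondegenerate_conic UNIV C_plus" and "C \<subseteq> C_plus"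
    and "conjugacy_matrix q S B"
  shows "normal_rational_curve (Fq q) 6 (V_bose q \<phi> C \<inter> \<Sigma>6) \<or>
         (normal_rational_curve (Fq q) 3 (V_bose q \<phi> C \<inter> \<Sigma>6) \<and>
          (\<exists>N t1 t2 t3.
             normal_rational_curve UNIV 3 N \<and>
             T_line q (\<phi> ` l_inf) t1 \<and> T_line q (\<phi> ` l_inf) t2 \<and> T_line q (\<phi> ` l_inf) t3 \<and>
             t1 \<noteq> t2 \<and> t1 \<noteq> t3 \<and> t2 \<noteq> t3 \<and>
             V_bose_star q \<phi> B C_plus \<inter> space_star \<Sigma>6 = N \<union> pts t1 \<union> pts t2 \<union> pts t3))"
proof -
  interpret cubic_extension q "TYPE('k)" using assms(1,3) by unfold_locales
  obtain A D0 where A: "invertible A" "homography A ` PG F = S" "nondegenerate_conic F D0"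
    "C = homography A ` D0"
    using assms(10) unfolding Fq_conic_in_def by blast
  obtain N where N: "\<forall>i j. N $ i $ j \<in> F" "invertible N" "D0 = (\<lambda>w. vec.span {N *v w}) ` conic_vecs F"
    using A(3) by (rule nondegenerate_conic_param)
  \<comment> \<open>\<open>A\<close> coordinatises the subplane and \<open>N\<close>, over
    \<open>F\<close>, straightens the conic in it; so \<open>M\<close> still maps vectors over
    \<open>F\<close> to points of the subplane.\<close>
  define M where "M = A ** N"
  have M_mult: "M *v x = A *v (N *v x)" for x by (simp add: M_def matrix_vector_mul_assoc)
  have M: "invertible M" unfolding M_def using A(1) N(2) by (rule invertible_mult)
  have C: "C = (\<lambda>w. vec.span {M *v w}) ` conic_vecs F"
    unfolding A(4) N(3) image_image homography_span_singleton M_mult ..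
  have S: "vec.span {M *v x} \<in> S" if x: "x \<in> vecs_over F" "x \<noteq> 0" for x
  proof -
    have "N *v x \<in> vecs_over F"
      using N(1) x(1) unfolding vecs_over_def matrix_vector_mult_def by (auto intro!: F_sum)
    moreover have "N *v x \<noteq> 0" using N(2) x(2) unfolding invertible_iff_ker by blast
    ultimately have "vec.span {N *v x} \<in> PG F" unfolding PG_def by blast
    then have "homography A (vec.span {N *v x}) \<in> S" using A(2) by blast
    then show ?thesis unfolding homography_span_singleton M_mult .
  qed
  have C_plus: "C_plus = (\<lambda>w. vec.span {M *v w}) ` conic_vecs UNIV"
    by (rule conic_extension[OF assms(11) _ M]) (use assms(2,12) C in auto)
  have "invertible B" using assms(13) by (simp add: conjugacy_matrix_def)
  moreover have "semilinear_coll q B (vec.span {M *v x}) = vec.span {M *v x}"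
    if "x \<in> vecs_over F" "x \<noteq> 0" for x
    using assms(13) S[OF that] by (simp add: conjugacy_matrix_def)
  ultimately obtain \<mu> where \<mu>: "\<mu> \<noteq> 0" "\<forall>y. B *v frob q (M *v y) = \<mu> *s (M *v frob q y)"
    by (rule conjugacy_scalar[OF M])
  interpret bose q "TYPE('k)" \<phi> M
  proof (intro bose.intro bose_axioms.intro)
    show "cubic_extension TYPE('k) q" by unfold_locales
  qed (use assms(4) M in \<open>auto simp: bose_embedding_def\<close>)
  have L: "vec.subspace l_inf" "vec.dim l_inf = 2" using assms(5) by (auto simp: pg_subspace_def)
  obtain D where D: "D \<subseteq> vecs_over F" "vec.independent D" "card D = 7" "\<Sigma>6 = PG F \<inter> pts (vec.span D)"
    using assms(6) by (auto simp: subgeom_space_def)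
  have "pts (conj_span q (\<phi> ` l_inf)) \<inter> PG F \<subseteq> pts (vec.span D)"
    using assms(7) D(4) unfolding bose_space_def by blast
  then obtain \<alpha> where \<alpha>: "\<forall>x. lin_form \<alpha> 0 x = 0 \<longleftrightarrow> M *v x \<in> l_inf"
    "\<forall>x y z. E 0 x + E 1 y + E 2 z \<in> vec.span D \<longleftrightarrow>
      lin_form \<alpha> 0 x = lin_form \<alpha> 1 y \<and> lin_form \<alpha> 1 y = lin_form \<alpha> 2 z"
    by (rule six_space_equation[OF L D(1-3)])
  \<comment> \<open>A nonzero solution would be a subplane point on the line at infinity.\<close>
  have \<alpha>_indep: "x = 0" if x: "x \<in> vecs_over F" "lin_form \<alpha> 0 x = 0" for x
  proof (rule ccontr)
    assume x0: "x \<noteq> 0"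
    then have "M *v x \<noteq> 0" using M unfolding invertible_iff_ker by blast
    moreover have "M *v x \<in> l_inf" using \<alpha>(1) x(2) by blast
    ultimately have "vec.span {M *v x} \<in> pts l_inf" unfolding pts_eq[OF L(1)] by blast
    then show False using S[OF x(1) x0] assms(9) by blast
  qed
  interpret cs: conic_scroll q "TYPE('k)" E \<alpha> "vec.span D"
    by unfold_locales
      (fact E_add E_scale E_frob E_add3 vec.subspace_span \<alpha>(2)[rule_format] | erule E_indep | erule (1) \<alpha>_indep)+
  have V: "V_bose q \<phi> C \<inter> \<Sigma>6 = (\<Union>w\<in>conic_vecs F. pts (cs.scroll w)) \<inter> PG F \<inter> pts (vec.span D)"
  proof -
    have "V_bose q \<phi> C = (\<Union>w\<in>conic_vecs F. pts (cs.scroll w) \<inter> PG F)"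
      unfolding V_bose_def C bose_space_def image_image cs.scroll_def
      using conj_span_point[OF conic_vecs_F] by simp
    then show ?thesis unfolding D(4) by blast
  qed
  have "vec.span (\<Union>\<Sigma>6) = vec.span D"
  proof (rule antisym)
    show "vec.span (\<Union>\<Sigma>6) \<subseteq> vec.span D"
      unfolding D(4) by (rule vec.span_minimal[OF _ vec.subspace_span]) (auto simp: pts_def)
    have "d \<in> \<Union>\<Sigma>6" if d: "d \<in> D" for d
    proof -
      have "d \<noteq> 0" using d D(2) vec.dependent_zero by blast
      then have "vec.span {d} \<in> \<Sigma>6"
        unfolding D(4) pts_eq[OF vec.subspace_span] PG_def using d D(1) vec.span_base[OF d] by blast
      then show ?thesis using vec.span_base[of d "{d}"] by blast
    qed
    then show "vec.span D \<subseteq> vec.span (\<Union>\<Sigma>6)" by (intro vec.span_mono subsetI)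
  qed
  then have star: "space_star \<Sigma>6 = pts (vec.span D)" by (simp add: space_star_def)
  have V_star: "V_bose_star q \<phi> B C_plus \<inter> space_star \<Sigma>6 =
      (\<Union>w\<in>conic_vecs UNIV. pts (cs.scroll w)) \<inter> pts (vec.span D)"
    unfolding star V_bose_star_def C_plus image_image scroll_plane_point[OF \<mu>(2)[rule_format] \<mu>(1)] cs.scroll_def ..
  have g: "cs.transversal 0 = \<phi> ` l_inf"
  proof (intro equalityI subsetI)
    fix u assume "u \<in> \<phi> ` l_inf"
    then obtain y where y: "u = \<phi> y" "y \<in> l_inf" by blast
    obtain x where x: "y = M *v x" using M by (rule invertible_surjE)
    then have "u = E 0 x" "lin_form \<alpha> 0 x = 0" using y \<alpha>(1) by (simp_all add: E_0_eq)
    then show "u \<in> cs.transversal 0" unfolding cs.transversal_def by blast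
  qed (auto simp: cs.transversal_def E_0_eq \<alpha>(1))
  show ?thesis
  proof (cases "comaximal (cs.fp 0) (cs.fp 1)")
    case True
    then interpret conic_scroll_curve q "TYPE('k)" E \<alpha> "vec.span D"
      "\<lambda>j. cs.fp (j + 1) * cs.fp (j + 2)" 6 "cs.fp 0 * cs.fp 1 * cs.fp 2"
      by (rule cs.conic_scroll_curve_coprime)
    show ?thesis unfolding V using scroll_F_nrc by blast
  next
    case False
    then obtain \<rho> where "poly (cs.fp 0) \<rho> = 0" "poly (cs.fp 0) (\<rho> ^ q) = 0" "\<rho> ^ q \<noteq> \<rho>"
      by (rule cs.fp_common_root)
    then interpret conic_scroll_split q "TYPE('k)" E \<alpha> "vec.span D" \<rho> by unfold_locales
    have neq: "tline 1 \<noteq> tline 0" "tline 2 \<noteq> tline 1" "tline 0 \<noteq> tline 2"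
      using tline_neq[of 0] tline_neq[of 1] tline_neq[of 2] unfolding index_add tline_add3 .
    have T: "T_line q (\<phi> ` l_inf) (tline 0)" "T_line q (\<phi> ` l_inf) (tline 1)"
      "T_line q (\<phi> ` l_inf) (tline 2)"
      unfolding g[symmetric] by (rule tline_T_line, simp)+
    show ?thesis
      unfolding V V_star scroll_star_eq
      by (rule disjI2, rule conjI[OF scroll_F_nrc], rule exI[of _ "cs.curve g 3 UNIV"],
          rule exI[of _ "tline 0"], rule exI[of _ "tline 1"], rule exI[of _ "tline 2"])
        (intro conjI curve_nrc(2) T neq neq[symmetric] refl)
  qed
qed

end
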